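(* Let $\nu\ge0$, $\alpha>-1$, and let $P_n^{\nu,\alpha}$ be the orthonormal polynomials with positive leading coefficients with respect to $x^\alpha\rho_\nu(x)\,dx$ on $(0,\infty)$. Then for $n\in\mathbb{N}_0$ and $x>0$ the Rodrigues type formula $$P_n^{\nu,\alpha}(x)=\frac{x^{-\alpha}}{\rho_\nu(x)}\frac{d^n}{dx^n}\Bigg[x^{n+\alpha}\Bigg[\rho_\nu(x)\sum_{j=0}^n\sum_{k=0}^j\sum_{m=0}^k\sum_{i=0}^{[m/2]}\frac{(-1)^{k+m}}{(j+n)!}c_{n,j+n}(n+\nu+\alpha+k+1)_{j-k}(\nu+i-m+1)_{m-2i}(m-2i+1)_i(\nu)_{k-m}\binom{j}{k}\binom{k}{m}\frac{x^i}{i!}$$ $$+\rho_{\nu+1}(x)\sum_{j=0}^n\sum_{k=0}^j\sum_{m=0}^{k-1}\sum_{i=0}^{[m/2]}\frac{(-1)^{k+m}}{(j+n)!}c_{n,j+n}(n+\nu+\alpha+k+1)_{j-k}(\nu+i-m)_{m-2i}(m-2i+1)_i(\nu)_{k-m-1}\binom{j}{k}\binom{k}{m+1}\frac{x^i}{i!}\Bigg]\Bigg]$$ holds. Moreover, $$P_{2n}^{\nu,\alpha}(x)=\sum_{j=n}^{2n}\frac{c_{2n,2j}}{(2j)!}A^\alpha_{j,j-1}(x)+\sum_{j=n}^{2n-1}\frac{c_{2n,2j+1}}{(2j+1)!}A^\alpha_{j,j}(x),$$ $$P_{2n+1}^{\nu,\alpha}(x)=\sum_{j=n}^{2n}\Big[\frac{c_{2n+1,2(j+1)}}{(2(j+1))!}A^\alpha_{j+1,j}(x)+\frac{c_{2n+1,2j+1}}{(2j+1)!}A^\alpha_{j,j}(x)\Big],$$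 where $$A^\alpha_{j,j-1}(x)=(\alpha+1)_{2j}\sum_{m=0}^j\binom{2j}{2m}\frac{x^m}{(\alpha+1)_{2m}}\,{}_3F_2\big(-2(j-m),\,m-\nu,\,m+1;\,2m+1+\alpha,\,2m+1;\,1\big),$$ $$A^\alpha_{j,j}(x)=(\alpha+1)_{2j+1}\sum_{m=0}^j\binom{2j+1}{2m}\frac{x^m}{(\alpha+1)_{2m}}\,{}_3F_2\big(-2(j-m)-1,\,m-\nu,\,m+1;\,2m+1+\alpha,\,2m+1;\,1\big).$$
   Context: For $\nu\in\mathbb{R}$, $x>0$, $\rho_\nu(x)=2x^{\nu/2}K_\nu(2\sqrt{x})$ with $K_\nu$ the modified Bessel function of the second kind. The $P_n^{\nu,\alpha}(x)=\sum_{k=0}^na_{n,k}x^k$ satisfy $\int_0^\infty P_n^{\nu,\alpha}P_m^{\nu,\alpha}x^\alpha\rho_\nu\,dx=\delta_{n,m}$. $(s)_n=s(s+1)\cdots(s+n-1)$ is the Pochhammer symbol, $[\cdot]$ the integer part, ${}_3F_2$ the generalized hypergeometric function, $L_k^\beta$ the associated Laguerre polynomial. The associated polynomial of $P_n^{\nu,\alpha}$ is $Q_{2n}(x)=\sum_{k=0}^na_{n,k}(-1)^kk!\,x^kL_k^\nu(x)$, and the coefficients $c_{n,k}$ are $$c_{n,k}=\frac{k!}{\Gamma(k+\nu+\alpha+1)}\int_0^\infty t^{\nu+\alpha}e^{-t}Q_{2n}(t)L_k^{\nu+\alpha}(t)\,dt,$$ i.e. the coefficients in $Q_{2n}=\sum_{k=0}^{2n}c_{n,k}L_k^{\nu+\alpha}$.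 *)

theory Defs
  imports "HOL-Analysis.Analysis"
begin

text \<open>Modified Bessel function of the second kind, via the standard integral
  representation K_nu(x) = int_0^infty exp(-x cosh t) cosh(nu t) dt (x > 0).\<close>
definition besselK :: "real \<Rightarrow> real \<Rightarrow> real" where
  "besselK \<nu> x = (LINT t:{0..}|lborel. exp (- x * cosh t) * cosh (\<nu> * t))"

definition rho :: "real \<Rightarrow> real \<Rightarrow> real" where
  "rho \<nu> x = 2 * x powr (\<nu> / 2) * besselK \<nu> (2 * sqrt x)"

definition laguerre :: "nat \<Rightarrow> real \<Rightarrow> real \<Rightarrow> real" where
  "laguerre k \<beta> x = (\<Sum>i\<le>k. (-1)^i * pochhammer (\<beta> + real i + 1) (k - i)
                                / (fact (k - i) * fact i) * x ^ i)"

definition hyp3F2 :: "real \<Rightarrow> real \<Rightarrow> real \<Rightarrow> real \<Rightarrow> real \<Rightarrow> real \<Rightarrow> real" where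
  "hyp3F2 a1 a2 a3 b1 b2 z =
     (\<Sum>k. pochhammer a1 k * pochhammer a2 k * pochhammer a3 k
           / (pochhammer b1 k * pochhammer b2 k * fact k) * z ^ k)"

definition orthonormal_family :: "real \<Rightarrow> real \<Rightarrow> (nat \<Rightarrow> real poly) \<Rightarrow> bool" where
  "orthonormal_family \<nu> \<alpha> P \<longleftrightarrow>
     (\<forall>n. degree (P n) = n \<and> lead_coeff (P n) > 0) \<and>
     (\<forall>n m. (LINT x:{0<..}|lborel. poly (P n) x * poly (P m) x * x powr \<alpha> * rho \<nu> x)
              = (if n = m then 1 else 0))"

definition Qassoc :: "real \<Rightarrow> (nat \<Rightarrow> real poly) \<Rightarrow> nat \<Rightarrow> real \<Rightarrow> real" where
  "Qassoc \<nu> P n x = (\<Sum>k\<le>n. coeff (P n) k * (-1)^k * fact k * x ^ k * laguerre k \<nu> x)"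

definition ccoef :: "real \<Rightarrow> real \<Rightarrow> (nat \<Rightarrow> real poly) \<Rightarrow> nat \<Rightarrow> nat \<Rightarrow> real" where
  "ccoef \<nu> \<alpha> P n k = fact k / Gamma (real k + \<nu> + \<alpha> + 1) *
     (LINT t:{0<..}|lborel. t powr (\<nu> + \<alpha>) * exp (- t) * Qassoc \<nu> P n t * laguerre k (\<nu> + \<alpha>) t)"

definition A_jjm1 :: "real \<Rightarrow> real \<Rightarrow> nat \<Rightarrow> real \<Rightarrow> real" where
  "A_jjm1 \<nu> \<alpha> j x = pochhammer (\<alpha> + 1) (2 * j) *
     (\<Sum>m\<le>j. real ((2 * j) choose (2 * m)) * x ^ m / pochhammer (\<alpha> + 1) (2 * m) *
        hyp3F2 (- 2 * (real j - real m)) (real m - \<nu>) (real m + 1)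
               (2 * real m + 1 + \<alpha>) (2 * real m + 1) 1)"

definition A_jj :: "real \<Rightarrow> real \<Rightarrow> nat \<Rightarrow> real \<Rightarrow> real" where
  "A_jj \<nu> \<alpha> j x = pochhammer (\<alpha> + 1) (2 * j + 1) *
     (\<Sum>m\<le>j. real ((2 * j + 1) choose (2 * m)) * x ^ m / pochhammer (\<alpha> + 1) (2 * m) *
        hyp3F2 (- 2 * (real j - real m) - 1) (real m - \<nu>) (real m + 1)
               (2 * real m + 1 + \<alpha>) (2 * real m + 1) 1)"

definition rod_S1 :: "real \<Rightarrow> real \<Rightarrow> (nat \<Rightarrow> real poly) \<Rightarrow> nat \<Rightarrow> real \<Rightarrow> real" where
  "rod_S1 \<nu> \<alpha> P n x =
    (\<Sum>j\<le>n. \<Sum>k\<le>j. \<Sum>m\<le>k. \<Sum>i\<le>m div 2.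
       (-1)^(k + m) / fact (j + n) * ccoef \<nu> \<alpha> P n (j + n)
       * pochhammer (real n + \<nu> + \<alpha> + real k + 1) (j - k)
       * pochhammer (\<nu> + real i - real m + 1) (m - 2 * i)
       * pochhammer (real m - 2 * real i + 1) i
       * pochhammer \<nu> (k - m)
       * real (j choose k) * real (k choose m) * x ^ i / fact i)"

definition rod_S2 :: "real \<Rightarrow> real \<Rightarrow> (nat \<Rightarrow> real poly) \<Rightarrow> nat \<Rightarrow> real \<Rightarrow> real" where
  "rod_S2 \<nu> \<alpha> P n x =
    (\<Sum>j\<le>n. \<Sum>k\<le>j. \<Sum>m<k. \<Sum>i\<le>m div 2.
       (-1)^(k + m) / fact (j + n) * ccoef \<nu> \<alpha> P n (j + n)
       * pochhammer (real n + \<nu> + \<alpha> + real k + 1) (j - k)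
       * pochhammer (\<nu> + real i - real m) (m - 2 * i)
       * pochhammer (real m - 2 * real i + 1) i
       * pochhammer \<nu> (k - m - 1)
       * real (j choose k) * real (k choose (m + 1)) * x ^ i / fact i)"

end

theory Submission
  imports Defs "HOL-Real_Asymp.Real_Asymp"
begin

text \<open>
  For fixed $x$ the values $\rho_{\nu+i}(x) = \int_0^\infty t^{\nu+i-1} e^{-t-x/t}\,dt$ are the moments of a
  linear functional $W$ on polynomials in $t$. The recurrence
  $\rho_{\nu+1} = x\rho_{\nu-1} + \nu\rho_\nu$ and the Chu--Vandermonde identity give
  $(-1)^k k!\,W(t^k L_k^\nu) = x^k\rho_\nu(x)$ and
  $k!\,W(L_k^{\nu+\alpha}) = x^{-\alpha} \frac{d^k}{dx^k}[x^{k+\alpha}\rho_\nu(x)]$.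
  Hence $P_n\rho_\nu = W(Q_{2n}) = \sum_k c_{n,k} W(L_k^{\nu+\alpha})$. Via the Mellin transform of $\rho_\nu$,
  orthogonality of $P_n$ becomes orthogonality of $Q_{2n}$ to $t^m$, $m < n$, with respect to
  $t^{\nu+\alpha}e^{-t}\,dt$, so only $n \le k \le 2n$ contribute; this is the Rodrigues formula.
  For the explicit formula, each $k$-th derivative is written as $A\rho_\nu + B\rho_{\nu+1}$ with polynomials
  $A, B$, and the $\rho_\nu$-components are compared: this is legitimate because
  $(\rho_{\nu+1}/\rho_\nu)^2$ grows like $x$, so $\rho_{\nu+1}/\rho_\nu$ is not a rational function.
\<close>

section \<open>Chu--Vandermonde sums\<close>

text \<open>Three functionals on polynomials occur, with moments
  \<open>rho (\<nu> + real i) x\<close>, \<open>Gamma (real i + \<beta> + 1)\<close>, and the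
  product of two Gamma values given by the Mellin transform of \<open>rho \<nu>\<close>. Treating
  all of them as moment sequences confines the analysis to Gamma integrals and a few facts about
  \<open>rho\<close>: recurrence, derivative, positivity, Turan inequality, Mellin transform. The
  rest is finite sums. The Rodrigues formula displays only n derivatives: for k = j + n the k-th
  derivative is split into n outer and j inner ones, and the inner expression d^j/dy^j
  [y^(n+\<alpha>+j) rho_\<nu>(y)] is written as a combination of \<open>rho \<nu>\<close> and
  \<open>rho (\<nu> + 1)\<close>. This is the origin of the index j + n and of the parameter n +
  \<nu> + \<alpha>. The sum over k in the statement is the Vandermonde identity read from right to
  left, with \<nu> in place of -\<nu>. Comparing components needs independence only over
  polynomials. Two-sided bounds on the ratio suffice for that, and they follow from the Turan
  inequality at two consecutive orders, so no asymptotic expansion of K_\<nu> enters.\<close>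

lemma pochhammer_reflect:
  fixes a :: real
  assumes "m \<le> k"
  shows "pochhammer (a + real m + 1) (k - m) = (-1) ^ (k - m) * pochhammer (- a - real k) (k - m)"
  using pochhammer_minus[of "a + real k" "k - m"] assms
  by (simp add: of_nat_diff algebra_simps)

text \<open>Reflection turns (b+i+1)_(k-i) into a rising factorial with the fixed base -b-k, and its
  sign absorbs (-1)^i. What remains is the binomial theorem for rising factorials with bases c and
  -b-k.\<close>

lemma vandermonde_alternating:
  fixes b c :: real
  shows "(\<Sum>i\<le>k. (-1) ^ i * real (k choose i) * pochhammer (b + real i + 1) (k - i) * pochhammer c i)
         = (-1) ^ k * pochhammer (c - b - real k) k"
proof -
  have "(\<Sum>i\<le>k. (-1) ^ i * real (k choose i) * pochhammer (b + real i + 1) (k - i) * pochhammer c i)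
      = (\<Sum>i\<le>k. (-1) ^ k * (real (k choose i) * pochhammer c i * pochhammer (- b - real k) (k - i)))"
  proof (intro sum.cong refl)
    fix i assume "i \<in> {..k}"
    then have "i \<le> k" by simp
    then have "(-1::real) ^ i * (-1) ^ (k - i) = (-1) ^ k"
      by (simp flip: power_add)
    then show "(-1) ^ i * real (k choose i) * pochhammer (b + real i + 1) (k - i) * pochhammer c i
      = (-1) ^ k * (real (k choose i) * pochhammer c i * pochhammer (- b - real k) (k - i))"
      unfolding pochhammer_reflect[OF \<open>i \<le> k\<close>] by (simp add: mult_ac)
  qed
  also have "\<dots> = (-1) ^ k * pochhammer (c + (- b - real k)) k"
    by (simp add: pochhammer_binomial_sum sum_distrib_left)
  finally show ?thesis by (simp add: algebra_simps)
qed

text \<open>Since binom(k,m) binom(m,i) = binom(k,i) binom(k-i,m-i), this is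
  \<open>vandermonde_alternating\<close> of order k - i. Taken with -\<nu> for b it produces
  Laguerre coefficients; taken with \<nu> for b it produces the double sums inside
  \<open>rod_S1\<close> and \<open>rod_S2\<close>.\<close>

lemma vandermonde_binomial:
  fixes a b :: real
  shows "(\<Sum>m\<le>k. real (k choose m) * real (m choose i) * (-1) ^ m
            * pochhammer (a + real m + 1) (k - m) * pochhammer b (m - i))
         = (-1) ^ i * real (k choose i) * pochhammer (a - b + real i + 1) (k - i)"
proof (cases "i \<le> k")
  case True
  define p where "p = k - i"
  have k: "k = i + p" using True by (simp add: p_def)
  have "(\<Sum>m\<le>k. real (k choose m) * real (m choose i) * (-1) ^ m
            * pochhammer (a + real m + 1) (k - m) * pochhammer b (m - i))
      = (\<Sum>m=i..k. real (k choose m) * real (m choose i) * (-1) ^ m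
            * pochhammer (a + real m + 1) (k - m) * pochhammer b (m - i))"
    by (intro sum.mono_neutral_right) auto
  also have "\<dots> = (\<Sum>s\<le>p. real (k choose (i + s)) * real ((i + s) choose i) * (-1) ^ (i + s)
            * pochhammer (a + real (i + s) + 1) (k - (i + s)) * pochhammer b s)"
    by (rule sum.reindex_bij_witness[of _ "\<lambda>s. i + s" "\<lambda>m. m - i"]) (auto simp: k)
  also have "\<dots> = (\<Sum>s\<le>p. (-1) ^ i * real (k choose i) *
       ((-1) ^ s * real (p choose s) * pochhammer ((a + real i) + real s + 1) (p - s) * pochhammer b s))"
  proof (intro sum.cong refl)
    fix s assume "s \<in> {..p}"
    then have "(k choose (i + s)) * ((i + s) choose i) = (k choose i) * (p choose s)"
      using choose_mult[of i "i + s" k] by (simp add: k)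
    then have *: "real (k choose (i + s)) * real ((i + s) choose i) = real (k choose i) * real (p choose s)"
      by (metis of_nat_mult)
    show "real (k choose (i + s)) * real ((i + s) choose i) * (-1) ^ (i + s)
            * pochhammer (a + real (i + s) + 1) (k - (i + s)) * pochhammer b s
        = (-1) ^ i * real (k choose i) *
       ((-1) ^ s * real (p choose s) * pochhammer ((a + real i) + real s + 1) (p - s) * pochhammer b s)"
      unfolding * by (simp add: k power_add add_ac mult_ac)
  qed
  also have "\<dots> = (-1) ^ i * real (k choose i) * ((-1) ^ p * pochhammer (b - (a + real i) - real p) p)"
    by (simp only: vandermonde_alternating flip: sum_distrib_left)
  also have "(-1) ^ p * pochhammer (b - (a + real i) - real p) p = pochhammer (a - b + real i + 1) p"
    using pochhammer_reflect[of 0 p "a - b + real i"] by (simp add: algebra_simps)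
  finally show ?thesis by (simp add: p_def)
next
  case False
  then have "real (k choose m) * real (m choose i) = 0" if "m \<le> k" for m
    using that by simp
  then show ?thesis using False by (simp add: sum.neutral)
qed

section \<open>Linear functionals given by moments, and Laguerre polynomials\<close>

text \<open>Integration against a weight is represented by its moment sequence alone, so linearity
  holds without integrability conditions and one set of lemmas serves all the weights.\<close>

definition moment_fun :: "(nat \<Rightarrow> real) \<Rightarrow> real poly \<Rightarrow> real" where
  "moment_fun \<mu> p = (\<Sum>i\<le>degree p. coeff p i * \<mu> i)"

lemma moment_fun_eq: "degree p \<le> N \<Longrightarrow> moment_fun \<mu> p = (\<Sum>i\<le>N. coeff p i * \<mu> i)"
  unfolding moment_fun_def by (rule sum.mono_neutral_left) (auto simp: coeff_eq_0)

lemma moment_fun_0 [simp]: "moment_fun \<mu> 0 = 0"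
  by (simp add: moment_fun_def)

lemma moment_fun_add: "moment_fun \<mu> (p + q) = moment_fun \<mu> p + moment_fun \<mu> q"
  using moment_fun_eq[of p "max (degree p) (degree q)"] moment_fun_eq[of q "max (degree p) (degree q)"]
    moment_fun_eq[of "p + q" "max (degree p) (degree q)"]
  by (simp add: degree_add_le_max algebra_simps sum.distrib)

lemma moment_fun_smult: "moment_fun \<mu> (smult c p) = c * moment_fun \<mu> p"
  using moment_fun_eq[of "smult c p" "degree p"]
  by (simp add: moment_fun_def sum_distrib_left algebra_simps degree_smult_le)

lemma moment_fun_sum: "moment_fun \<mu> (\<Sum>i\<in>A. f i) = (\<Sum>i\<in>A. moment_fun \<mu> (f i))"
  by (induction A rule: infinite_finite_induct) (auto simp: moment_fun_add)

lemma moment_fun_monom: "moment_fun \<mu> (monom c n) = c * \<mu> n"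
  using moment_fun_eq[of "monom c n" n] by (simp add: degree_monom_le mult_delta_left)

lemma poly_expand_basis:
  fixes F :: "nat \<Rightarrow> real poly"
  assumes "\<And>k. degree (F k) = k" and "\<And>k. F k \<noteq> 0" and "degree p \<le> N"
  shows "\<exists>d. p = (\<Sum>k\<le>N. smult (d k) (F k))"
  using assms(3)
proof (induction N arbitrary: p)
  case 0
  then obtain c where c: "p = [:c:]" by (auto elim: degree_eq_zeroE)
  obtain b where b: "F 0 = [:b:]" using assms(1)[of 0] by (auto elim: degree_eq_zeroE)
  with assms(2)[of 0] have "b \<noteq> 0" by auto
  then show ?case by (intro exI[of _ "\<lambda>_. c / b"]) (simp add: c b)
next
  case (Suc N)
  have lc: "coeff (F (Suc N)) (Suc N) \<noteq> 0"
    using assms(1,2)[of "Suc N"] by (metis leading_coeff_0_iff)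
  define e where "e = coeff p (Suc N) / coeff (F (Suc N)) (Suc N)"
  have "degree (p - smult e (F (Suc N))) \<le> N"
  proof (rule degree_le, intro allI impI)
    fix i assume "N < i"
    then consider "i = Suc N" | "i > Suc N" by linarith
    then show "coeff (p - smult e (F (Suc N))) i = 0"
    proof cases
      case 1
      then show ?thesis using lc by (simp add: e_def)
    next
      case 2
      then show ?thesis using Suc.prems assms(1)[of "Suc N"] by (simp add: coeff_eq_0)
    qed
  qed
  from Suc.IH[OF this] obtain d where d: "p - smult e (F (Suc N)) = (\<Sum>k\<le>N. smult (d k) (F k))"
    by blast
  have "p = (\<Sum>k\<le>Suc N. smult ((d(Suc N := e)) k) (F k))"
    using d by (simp add: algebra_simps)
  then show ?case by blast
qed

section \<open>Laguerre polynomials as elements of \<open>real poly\<close>\<close>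

definition laguerre_poly :: "nat \<Rightarrow> real \<Rightarrow> real poly" where
  "laguerre_poly k \<beta> = (\<Sum>i\<le>k. monom ((-1)^i * pochhammer (\<beta> + real i + 1) (k - i)
                                / (fact (k - i) * fact i)) i)"

lemma poly_laguerre_poly [simp]: "poly (laguerre_poly k \<beta>) x = laguerre k \<beta> x"
  by (simp add: laguerre_poly_def laguerre_def poly_sum poly_monom)

lemma coeff_laguerre_poly: "coeff (laguerre_poly k \<beta>) i =
   (if i \<le> k then (-1)^i * pochhammer (\<beta> + real i + 1) (k - i) / (fact (k - i) * fact i) else 0)"
  by (simp add: laguerre_poly_def coeff_sum coeff_monom sum.delta)

lemma degree_laguerre_poly [simp]: "degree (laguerre_poly k \<beta>) = k"
  by (rule antisym) (auto intro!: degree_le le_degree simp: coeff_laguerre_poly)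

lemma laguerre_poly_nonzero [simp]: "laguerre_poly k \<beta> \<noteq> 0"
  by (metis coeff_0 coeff_laguerre_poly diff_self_eq_0 divide_eq_0_iff fact_nonzero le_refl
      mult_eq_0_iff one_neq_zero pochhammer_0 power_eq_0_iff neg_equal_0_iff_equal)

lemma moment_fun_monom_laguerre:
  "moment_fun \<mu> (monom 1 m * laguerre_poly k \<beta>)
     = (\<Sum>i\<le>k. (-1)^i * real (k choose i) * pochhammer (\<beta> + real i + 1) (k - i) * \<mu> (m + i)) / fact k"
  by (simp add: laguerre_poly_def sum_distrib_left mult_monom moment_fun_sum moment_fun_monom sum_divide_distrib
      binomial_fact mult_ac)

text \<open>Gamma(m+i+\<beta>+1) is (m+\<beta>+1)_i times a constant, so the sum is
  \<open>vandermonde_alternating\<close>. The Laguerre parameter b is kept separate from \<beta>: b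
  = \<beta> gives orthogonality, while b = \<nu> with \<beta> = \<nu> + \<alpha> links the
  associated polynomial to the moments of \<open>rho \<nu>\<close>.\<close>

lemma moment_fun_Gamma_laguerre:
  assumes "\<beta> > -1"
  shows "moment_fun (\<lambda>i. Gamma (real i + \<beta> + 1)) (monom 1 m * laguerre_poly k b)
     = (-1) ^ k * pochhammer (real m + \<beta> + 1 - b - real k) k * Gamma (real m + \<beta> + 1) / fact k"
proof -
  have G: "Gamma (real (m + i) + \<beta> + 1) = pochhammer (real m + \<beta> + 1) i * Gamma (real m + \<beta> + 1)" for i
  proof -
    have pos: "real m + \<beta> + 1 > 0" using assms by linarith
    then have "real m + \<beta> + 1 \<notin> \<int>\<^sub>\<le>\<^sub>0" by (auto elim!: nonpos_Ints_cases)
    from pochhammer_Gamma[OF this, of i] Gamma_real_pos[OF pos] show ?thesis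
      by (simp add: field_simps)
  qed
  show ?thesis
    unfolding moment_fun_monom_laguerre G
    using vandermonde_alternating[of k b "real m + \<beta> + 1"]
    by (simp add: mult.assoc[symmetric] flip: sum_distrib_right)
qed

section \<open>Consequences of the three-term recurrence\<close>

text \<open>Trades powers of x for higher orders with constant coefficients. The right side is the
  functional with moments r(\<nu>+i) applied to (-1)^m m! L_m^(\<nu>-m). In the induction the
  hypothesis is used at \<nu> - 1, and the recurrence raises each of its terms.\<close>

lemma shift_up_expansion:
  fixes r :: "real \<Rightarrow> real"
  assumes rec: "\<And>\<mu>. r (\<mu> + 1) = x * r (\<mu> - 1) + \<mu> * r \<mu>"
  shows "x ^ m * r (\<nu> - real m) = (\<Sum>i\<le>m. real (m choose i) * pochhammer (- \<nu>) (m - i) * r (\<nu> + real i))"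
proof (induction m arbitrary: \<nu>)
  case 0
  show ?case by simp
next
  case (Suc m)
  have step: "x * r (\<nu> - 1 + real i) = r (\<nu> + real (Suc i)) - (\<nu> + real i) * r (\<nu> + real i)" for i
    using rec[of "\<nu> + real i"] by (simp add: algebra_simps)
  define p where "p = (\<lambda>j. pochhammer (1 - \<nu>) j)"
  have "x ^ Suc m * r (\<nu> - real (Suc m)) = x * (x ^ m * r ((\<nu> - 1) - real m))"
    by (simp add: algebra_simps)
  also have "\<dots> = (\<Sum>i\<le>m. real (m choose i) * p (m - i) * (x * r (\<nu> - 1 + real i)))"
    unfolding Suc.IH by (simp add: sum_distrib_left mult_ac p_def)
  also have "\<dots> = (\<Sum>i\<le>m. real (m choose i) * p (m - i) * r (\<nu> + real (Suc i)))
       - (\<Sum>i\<le>m. real (m choose i) * p (m - i) * (\<nu> + real i) * r (\<nu> + real i))"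
    unfolding step by (simp add: algebra_simps sum_subtractf)
  \<comment> \<open>The added top term carries \<open>m choose Suc m\<close> = 0; it lets this sum
    be shifted to the range of the other one.\<close>
  also have "(\<Sum>i\<le>m. real (m choose i) * p (m - i) * (\<nu> + real i) * r (\<nu> + real i))
      = (\<Sum>i\<le>Suc m. real (m choose i) * p (m - i) * (\<nu> + real i) * r (\<nu> + real i))"
    by simp
  also have "\<dots> = p m * \<nu> * r \<nu>
      + (\<Sum>i\<le>m. real (m choose Suc i) * p (m - Suc i) * (\<nu> + real (Suc i)) * r (\<nu> + real (Suc i)))"
    by (subst sum.atMost_Suc_shift) simp
  also have "(\<Sum>i\<le>m. real (m choose i) * p (m - i) * r (\<nu> + real (Suc i))) - \<dots>
     = - \<nu> * p m * r \<nu> + (\<Sum>i\<le>m. (real (m choose i) * p (m - i) -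
         real (m choose Suc i) * p (m - Suc i) * (\<nu> + real (Suc i))) * r (\<nu> + real (Suc i)))"
    by (simp add: sum_subtractf algebra_simps)
  also have "\<dots> = - \<nu> * p m * r \<nu> +
      (\<Sum>i\<le>m. real (Suc m choose Suc i) * pochhammer (- \<nu>) (m - i) * r (\<nu> + real (Suc i)))"
  proof (intro arg_cong2[of _ _ _ _ "(+)"] sum.cong refl arg_cong2[of _ _ _ _ "(*)"])
    fix i assume "i \<in> {..m}"
    show "real (m choose i) * p (m - i) -
         real (m choose Suc i) * p (m - Suc i) * (\<nu> + real (Suc i))
       = real (Suc m choose Suc i) * pochhammer (- \<nu>) (m - i)"
    proof (cases "i = m")
      case True
      then show ?thesis by (simp add: p_def)
    next
      case False
      with \<open>i \<in> {..m}\<close> obtain q where q: "m = Suc (i + q)"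
        by (metis atMost_iff le_neq_implies_less less_iff_Suc_add)
      \<comment> \<open>With m - i = q + 1 every Pochhammer symbol is a linear factor times
        \<open>p q\<close>, so the claim reduces to this absorption identity and Pascal's
        rule.\<close>
      have "Suc i * (m choose Suc i) = Suc q * (m choose i)"
        using Suc_times_binomial_add[of i q] by (simp add: q)
      then have *: "(1 + real i) * real (m choose Suc i) = (1 + real q) * real (m choose i)"
        by (metis of_nat_Suc of_nat_mult)
      have p1: "p (m - i) = (1 - \<nu> + real q) * p q" "p (m - Suc i) = p q"
        by (simp_all add: p_def q pochhammer_rec' Suc_diff_le)
      have p2: "pochhammer (- \<nu>) (m - i) = - \<nu> * p q"
        by (simp add: p_def q pochhammer_rec[of "- \<nu>"] Suc_diff_le)
      have "real (m choose i) * p (m - i) - real (m choose Suc i) * p (m - Suc i) * (\<nu> + real (Suc i))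
        = p q * (real (m choose i) * (1 - \<nu> + real q) - \<nu> * real (m choose Suc i)
            - (1 + real i) * real (m choose Suc i))"
        unfolding p1 by (simp add: algebra_simps)
      also have "\<dots> = real (Suc m choose Suc i) * pochhammer (- \<nu>) (m - i)"
        unfolding * p2 by (simp add: algebra_simps)
      finally show ?thesis .
    qed
  qed
  also have "- \<nu> * p m * r \<nu> = real (Suc m choose 0) * pochhammer (- \<nu>) (Suc m - 0) * r (\<nu> + real 0)"
    by (simp add: p_def pochhammer_rec[of "- \<nu>"])
  also have "\<dots> + (\<Sum>i\<le>m. real (Suc m choose Suc i) * pochhammer (- \<nu>) (m - i) * r (\<nu> + real (Suc i)))
     = (\<Sum>i\<le>Suc m. real (Suc m choose i) * pochhammer (- \<nu>) (Suc m - i) * r (\<nu> + real i))"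
    by (subst sum.atMost_Suc_shift) simp
  finally show ?case .
qed

text \<open>This is \<open>shift_up_expansion\<close> at order \<nu> + k: there (-(\<nu>+k))_(k-i)
  reflects to (\<nu>+i+1)_(k-i), the coefficient in L_k^\<nu>, and r(\<nu>+k+i) is the moment of
  t^(k+i).\<close>

lemma moment_fun_power_laguerre:
  fixes r :: "real \<Rightarrow> real"
  assumes rec: "\<And>\<mu>. r (\<mu> + 1) = x * r (\<mu> - 1) + \<mu> * r \<mu>"
  shows "(-1) ^ k * fact k * moment_fun (\<lambda>i. r (\<nu> + real i)) (monom 1 k * laguerre_poly k \<nu>) = x ^ k * r \<nu>"
proof -
  have "(-1) ^ k * fact k * moment_fun (\<lambda>i. r (\<nu> + real i)) (monom 1 k * laguerre_poly k \<nu>)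
     = (\<Sum>i\<le>k. (-1) ^ k * ((-1)^i * real (k choose i) * pochhammer (\<nu> + real i + 1) (k - i) * r (\<nu> + real (k + i))))"
    unfolding moment_fun_monom_laguerre by (simp flip: sum_distrib_left)
  also have "\<dots> = (\<Sum>i\<le>k. real (k choose i) * pochhammer (- (\<nu> + real k)) (k - i) * r (\<nu> + real k + real i))"
  proof (intro sum.cong refl)
    fix i assume "i \<in> {..k}"
    then have i: "i \<le> k" by simp
    then have "(-1::real) ^ k * (-1) ^ i * (-1) ^ (k - i) = 1"
      by (simp flip: power_add add: mult_2[symmetric])
    then show "(-1) ^ k * ((-1)^i * real (k choose i) * pochhammer (\<nu> + real i + 1) (k - i) * r (\<nu> + real (k + i)))
      = real (k choose i) * pochhammer (- (\<nu> + real k)) (k - i) * r (\<nu> + real k + real i)"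
      unfolding pochhammer_reflect[OF i] by (simp add: add.assoc)
  qed
  also have "\<dots> = x ^ k * r \<nu>"
    using shift_up_expansion[of r x k "\<nu> + real k", OF rec] by simp
  finally show ?thesis .
qed

text \<open>For r = \<open>rho\<close> the right side is x^(-\<alpha>) times the k-th derivative of
  x^(k+\<alpha>) rho_\<nu>(x) by the Leibniz rule, since the m-th derivative of rho_\<nu> is (-1)^m
  rho_(\<nu>-m). Raising each term by \<open>shift_up_expansion\<close> and summing over m with
  \<open>vandermonde_binomial\<close> moves the parameter from \<alpha> to \<nu> + \<alpha>.\<close>

lemma moment_fun_laguerre:
  fixes r :: "real \<Rightarrow> real"
  assumes rec: "\<And>\<mu>. r (\<mu> + 1) = x * r (\<mu> - 1) + \<mu> * r \<mu>"
  shows "fact k * moment_fun (\<lambda>i. r (\<nu> + real i)) (laguerre_poly k (\<nu> + \<alpha>))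
     = (\<Sum>m\<le>k. real (k choose m) * pochhammer (\<alpha> + real m + 1) (k - m) * (-1) ^ m * (x ^ m * r (\<nu> - real m)))"
proof -
  have ext: "x ^ m * r (\<nu> - real m)
      = (\<Sum>i\<le>k. real (m choose i) * pochhammer (- \<nu>) (m - i) * r (\<nu> + real i))" if "m \<le> k" for m
    unfolding shift_up_expansion[of r x, OF rec] using that
    by (intro sum.mono_neutral_left) (auto simp: binomial_eq_0)
  have "(\<Sum>m\<le>k. real (k choose m) * pochhammer (\<alpha> + real m + 1) (k - m) * (-1) ^ m * (x ^ m * r (\<nu> - real m)))
     = (\<Sum>m\<le>k. \<Sum>i\<le>k. real (k choose m) * real (m choose i) * (-1) ^ m * pochhammer (\<alpha> + real m + 1) (k - m) *
          pochhammer (- \<nu>) (m - i) * r (\<nu> + real i))"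
    by (intro sum.cong refl) (simp add: ext sum_distrib_left mult_ac)
  also have "\<dots> = (\<Sum>i\<le>k. (\<Sum>m\<le>k. real (k choose m) * real (m choose i) * (-1) ^ m * pochhammer (\<alpha> + real m + 1) (k - m) *
          pochhammer (- \<nu>) (m - i)) * r (\<nu> + real i))"
    by (subst sum.swap) (simp add: sum_distrib_right)
  also have "\<dots> = (\<Sum>i\<le>k. (-1) ^ i * real (k choose i) * pochhammer (\<nu> + \<alpha> + real i + 1) (k - i) * r (\<nu> + real i))"
    unfolding vandermonde_binomial by (simp add: algebra_simps)
  also have "\<dots> = fact k * moment_fun (\<lambda>i. r (\<nu> + real i)) (laguerre_poly k (\<nu> + \<alpha>))"
    using moment_fun_monom_laguerre[of "\<lambda>i. r (\<nu> + real i)" 0 k "\<nu> + \<alpha>"] by (simp add: monom_0 one_pCons[symmetric])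
  finally show ?thesis by simp
qed

text \<open>The coefficients in $x^m\rho_{\nu-m} = R_m\rho_\nu + R'_m\rho_{\nu+1}$, obtained by iterating
  $x\rho_{\mu-1} = \rho_{\mu+1} - \mu\rho_\mu$; here $R'_m(\nu) = R_{m-1}(\nu-1)$.\<close>
fun bessel_poly :: "nat \<Rightarrow> real \<Rightarrow> real poly" where
  "bessel_poly 0 \<nu> = 1"
| "bessel_poly (Suc 0) \<nu> = [:- \<nu>:]"
| "bessel_poly (Suc (Suc m)) \<nu> = [:0, 1:] * bessel_poly m \<nu> - smult (\<nu> - real (Suc m)) (bessel_poly (Suc m) \<nu>)"

text \<open>Iterating the Bessel recurrence yields polynomials of Lommel type. The form with
  \<open>(m - i) choose i\<close> vanishes by itself for 2i > m, so any upper limit N from m on is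
  allowed, and the sums for m, m+1 and m+2 can be matched coefficient by coefficient.\<close>

lemma poly_bessel_poly_choose:
  assumes "m \<le> N"
  shows "poly (bessel_poly m \<nu>) x = (-1) ^ m * (\<Sum>i\<le>N. real ((m - i) choose i) * pochhammer (\<nu> + real i - real m + 1) (m - 2 * i) * x ^ i)"
  using assms
proof (induction m \<nu> arbitrary: N rule: bessel_poly.induct)
  case (1 \<nu>)
  have "(\<Sum>i\<le>N. real ((0 - i) choose i) * pochhammer (\<nu> + real i - real 0 + 1) (0 - 2 * i) * x ^ i)
     = (\<Sum>i\<le>N. if i = 0 then 1 else 0)"
    by (intro sum.cong) auto
  then show ?case by simp
next
  case (2 \<nu>)
  have "(\<Sum>i\<le>N. real ((Suc 0 - i) choose i) * pochhammer (\<nu> + real i - real (Suc 0) + 1) (Suc 0 - 2 * i) * x ^ i)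
     = (\<Sum>i\<le>N. if i = 0 then \<nu> else 0)"
    by (intro sum.cong) auto
  then show ?case by simp
next
  case (3 m \<nu>)
  then obtain M where N: "N = Suc M" and M: "m \<le> M" "Suc m \<le> M + 1" by (cases N) auto
  define f where "f = (\<lambda>m i. real ((m - i) choose i) * pochhammer (\<nu> + real i - real m + 1) (m - 2 * i))"
  have step: "f (Suc (Suc m)) (Suc i) = f m i + (\<nu> - real (Suc m)) * f (Suc m) (Suc i)" for i
  proof -
    consider "m < 2 * i" | "m = 2 * i" | "m \<ge> 2 * i + 1" by linarith
    then show ?thesis
    proof cases
      case 1
      then show ?thesis by (simp add: f_def binomial_eq_0)
    next
      case 2
      then show ?thesis by (simp add: f_def)
    next
      case 3
      then obtain q where q: "m = 2 * i + 1 + q" by (metis le_iff_add)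
      \<comment> \<open>With this base the symbols of rows m, m+1 and m+2 are P (a + q), P and (a -
        1) P, where P = (a)_q; only a relation between two neighbouring binomials remains.\<close>
      define a where "a = \<nu> - real i - real q"
      have A: "Suc i * ((i + Suc q) choose Suc i) = Suc q * ((i + Suc q) choose i)"
        using Suc_times_binomial_add[of i q] by simp
      then have *: "(1 + real i) * real ((i + Suc q) choose Suc i) = (1 + real q) * real ((i + Suc q) choose i)"
        by (metis of_nat_Suc of_nat_mult)
      define c1 where "c1 = real ((i + Suc q) choose i)"
      define c2 where "c2 = real ((i + Suc q) choose Suc i)"
      define P where "P = pochhammer a q"
      have e1: "f m i = c1 * (P * (a + real q))"
        by (simp add: f_def c1_def P_def q a_def pochhammer_rec' algebra_simps)
      have e2: "f (Suc m) (Suc i) = c2 * P"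
        by (simp add: f_def c2_def P_def q a_def algebra_simps)
      have e3: "f (Suc (Suc m)) (Suc i) = (c1 + c2) * ((a - 1) * P)"
        by (simp add: f_def c1_def c2_def P_def q a_def pochhammer_rec algebra_simps)
      have "(1 + real i) * c2 = (1 + real q) * c1" using * by (simp add: c1_def c2_def)
      then have "P * ((1 + real i) * c2) = P * ((1 + real q) * c1)" by simp
      then show ?thesis unfolding e1 e2 e3 by (simp add: q a_def algebra_simps)
    qed
  qed
  have f0: "f (Suc (Suc m)) 0 = (\<nu> - real (Suc m)) * f (Suc m) 0"
    by (simp add: f_def pochhammer_rec[of "\<nu> - (1 + real m)"] algebra_simps)
  have "(\<Sum>i\<le>N. f (Suc (Suc m)) i * x ^ i) = f (Suc (Suc m)) 0 + (\<Sum>i\<le>M. f (Suc (Suc m)) (Suc i) * x ^ Suc i)"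
    unfolding N by (subst sum.atMost_Suc_shift) simp
  also have "\<dots> = x * (\<Sum>i\<le>M. f m i * x ^ i) + (\<nu> - real (Suc m)) * (f (Suc m) 0 + (\<Sum>i\<le>M. f (Suc m) (Suc i) * x ^ Suc i))"
    unfolding step f0 by (simp add: algebra_simps sum.distrib sum_distrib_left sum_subtractf)
  also have "f (Suc m) 0 + (\<Sum>i\<le>M. f (Suc m) (Suc i) * x ^ Suc i) = (\<Sum>i\<le>N. f (Suc m) i * x ^ i)"
    unfolding N by (subst sum.atMost_Suc_shift) simp
  finally have main: "(\<Sum>i\<le>N. f (Suc (Suc m)) i * x ^ i)
      = x * (\<Sum>i\<le>M. f m i * x ^ i) + (\<nu> - real (Suc m)) * (\<Sum>i\<le>N. f (Suc m) i * x ^ i)" .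
  have "poly (bessel_poly m \<nu>) x = (-1) ^ m * (\<Sum>i\<le>M. f m i * x ^ i)"
    "poly (bessel_poly (Suc m) \<nu>) x = (-1) ^ Suc m * (\<Sum>i\<le>N. f (Suc m) i * x ^ i)"
    using "3.IH"(1)[of M] "3.IH"(2)[of N] M N by (simp_all only: f_def)
  then have "poly (bessel_poly (Suc (Suc m)) \<nu>) x = (-1) ^ Suc (Suc m) * (\<Sum>i\<le>N. f (Suc (Suc m)) i * x ^ i)"
    unfolding main by (simp add: algebra_simps)
  then show ?case by (simp only: f_def)
qed

lemma poly_bessel_poly:
  "poly (bessel_poly m \<nu>) x = (-1) ^ m * (\<Sum>i\<le>m div 2. pochhammer (\<nu> + real i - real m + 1) (m - 2 * i)
      * pochhammer (real m - 2 * real i + 1) i * x ^ i / fact i)"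
proof -
  have "(\<Sum>i\<le>m. real ((m - i) choose i) * pochhammer (\<nu> + real i - real m + 1) (m - 2 * i) * x ^ i)
    = (\<Sum>i\<le>m div 2. real ((m - i) choose i) * pochhammer (\<nu> + real i - real m + 1) (m - 2 * i) * x ^ i)"
    by (intro sum.mono_neutral_right) (auto simp: binomial_eq_0)
  also have "\<dots> = (\<Sum>i\<le>m div 2. pochhammer (\<nu> + real i - real m + 1) (m - 2 * i)
      * pochhammer (real m - 2 * real i + 1) i * x ^ i / fact i)"
  proof (intro sum.cong refl)
    fix i assume "i \<in> {..m div 2}"
    then have i: "2 * i \<le> m" by auto
    have "real ((m - i) choose i) = pochhammer (real (m - i) - real i + 1) i / fact i"
      by (simp add: binomial_gbinomial gbinomial_pochhammer')
    also have "real (m - i) - real i = real m - 2 * real i"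
      using i by (simp add: of_nat_diff)
    finally show "real ((m - i) choose i) * pochhammer (\<nu> + real i - real m + 1) (m - 2 * i) * x ^ i
      = pochhammer (\<nu> + real i - real m + 1) (m - 2 * i) * pochhammer (real m - 2 * real i + 1) i * x ^ i / fact i"
      by simp
  qed
  finally show ?thesis using poly_bessel_poly_choose[of m m \<nu> x] by simp
qed

definition bessel_poly' :: "nat \<Rightarrow> real \<Rightarrow> real poly" where
  "bessel_poly' m \<nu> = (if m = 0 then 0 else bessel_poly (m - 1) (\<nu> - 1))"

lemma shift_down_bessel_poly:
  fixes r :: "real \<Rightarrow> real"
  assumes rec: "\<And>\<mu>. r (\<mu> + 1) = x * r (\<mu> - 1) + \<mu> * r \<mu>"
  shows "x ^ m * r (\<nu> - real m) = poly (bessel_poly m \<nu>) x * r \<nu> + poly (bessel_poly' m \<nu>) x * r (\<nu> + 1)"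
proof (induction m \<nu> rule: bessel_poly.induct)
  case (1 \<nu>)
  show ?case by (simp add: bessel_poly'_def)
next
  case (2 \<nu>)
  show ?case using rec[of \<nu>] by (simp add: bessel_poly'_def algebra_simps)
next
  case (3 m \<nu>)
  have "x ^ Suc (Suc m) * r (\<nu> - real (Suc (Suc m))) = x ^ Suc m * (x * r ((\<nu> - real (Suc m)) - 1))"
    by (simp add: algebra_simps)
  also have "\<dots> = x * (x ^ m * r (\<nu> - real m)) - (\<nu> - real (Suc m)) * (x ^ Suc m * r (\<nu> - real (Suc m)))"
  proof -
    have "x * r ((\<nu> - real (Suc m)) - 1) = r (\<nu> - real m) - (\<nu> - real (Suc m)) * r (\<nu> - real (Suc m))"
      using rec[of "\<nu> - real (Suc m)"] by (simp add: algebra_simps)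
    then show ?thesis by (simp only:) (simp add: algebra_simps)
  qed
  also have "\<dots> = poly (bessel_poly (Suc (Suc m)) \<nu>) x * r \<nu> +
      (x * poly (bessel_poly' m \<nu>) x - (\<nu> - real (Suc m)) * poly (bessel_poly' (Suc m) \<nu>) x) * r (\<nu> + 1)"
    unfolding 3 by (simp add: algebra_simps)
  also have "x * poly (bessel_poly' m \<nu>) x - (\<nu> - real (Suc m)) * poly (bessel_poly' (Suc m) \<nu>) x
     = poly (bessel_poly' (Suc (Suc m)) \<nu>) x"
    by (cases m) (simp_all add: bessel_poly'_def algebra_simps)
  finally show ?case .
qed

section \<open>Integral representation of the functions rho\<close>

definition rho_kernel :: "real \<Rightarrow> real \<Rightarrow> real \<Rightarrow> real" where
  "rho_kernel \<nu> x t = t powr (\<nu> - 1) * exp (- t - x / t)"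

lemma rho_kernel_nonneg: "rho_kernel \<nu> x t \<ge> 0"
  by (simp add: rho_kernel_def)

lemma rho_kernel_measurable [measurable]: "rho_kernel \<nu> x \<in> borel_measurable borel"
  unfolding rho_kernel_def by measurable

section \<open>Gamma integrals, the kernel representation and its consequences\<close>

lemma nn_integral_Gamma:
  assumes "s > 0"
  shows "(\<integral>\<^sup>+t. ennreal (indicator {0<..} t * (t powr (s - 1) * exp (- t))) \<partial>lborel) = ennreal (Gamma s)"
proof -
  have "(\<integral>\<^sup>+t. ennreal (indicator {0..} t * (t powr (s - 1) / exp t)) \<partial>lborel) = ennreal (Gamma s)"
    using nn_integral_has_integral_lebesgue[OF _ Gamma_integral_real[OF assms]] by simp
  moreover have "indicator {0<..} t * (t powr (s - 1) * exp (- t)) = indicator {0..} t * (t powr (s - 1) / exp t)" for t :: real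
    by (auto simp: indicator_def exp_minus field_simps)
  ultimately show ?thesis by simp
qed

lemma Gamma_lebesgue:
  fixes s :: real
  assumes "s > 0"
  shows "set_integrable lborel {0<..} (\<lambda>t. t powr (s - 1) * exp (- t))"
    and "(LINT t:{0<..}|lborel. t powr (s - 1) * exp (- t)) = Gamma s"
proof -
  have nn: "(\<integral>\<^sup>+t. ennreal (indicat_real {0<..} t * (t powr (s - 1) * exp (- t))) \<partial>lborel) = ennreal (Gamma s)"
    using nn_integral_Gamma[OF assms] by simp
  have "has_bochner_integral lborel (\<lambda>t. indicat_real {0<..} t * (t powr (s - 1) * exp (- t))) (Gamma s)"
    using Gamma_real_pos[OF assms] by (intro has_bochner_integral_nn_integral nn) auto
  then show "set_integrable lborel {0<..} (\<lambda>t. t powr (s - 1) * exp (- t))"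
    and "(LINT t:{0<..}|lborel. t powr (s - 1) * exp (- t)) = Gamma s"
    by (auto simp: set_integrable_def set_lebesgue_integral_def has_bochner_integral_iff)
qed

text \<open>Every real order is needed, because the derivative and the downward shifts lower \<nu>.
  Near 0 the factor exp(-x/t) beats any power: keeping one term u^p/p! of the series of exp(u) at u
  = x/t, with p > -\<nu>, dominates the kernel by a convergent Gamma integrand.\<close>

lemma rho_kernel_integrable:
  assumes "x > 0"
  shows "set_integrable lborel {0<..} (rho_kernel \<nu> x)"
proof -
  obtain p :: nat where "- \<nu> < real p"
    using reals_Archimedean2 by blast
  then have p: "\<nu> + real p > 0" by linarith
  have "set_integrable lborel {0<..} (\<lambda>t. fact p / x ^ p * (t powr (\<nu> + real p - 1) * exp (- t)))"
    by (intro set_integrable_mult_right Gamma_lebesgue p)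
  then show ?thesis
  proof (rule set_integrable_bound)
    show "AE t in lborel. t \<in> {0<..} \<longrightarrow> norm (rho_kernel \<nu> x t) \<le> norm (fact p / x ^ p * (t powr (\<nu> + real p - 1) * exp (- t)))"
    proof (intro AE_I2 impI)
      fix t :: real assume "t \<in> {0<..}"
      then have t: "t > 0" by simp
      have "(x / t) ^ p / fact p \<le> exp (x / t)"
      proof -
        have "(x / t) ^ p / fact p \<le> (\<Sum>n. (x / t) ^ n /\<^sub>R fact n)"
          using sum_le_suminf[OF summable_exp_generic[of "x / t"], of "{p}"] t assms
          by (simp add: divide_inverse_commute)
        then show ?thesis by (simp add: exp_def)
      qed
      then have "exp (- (x / t)) \<le> fact p * t ^ p / x ^ p"
        using t assms by (simp add: exp_minus field_simps)
      then have "rho_kernel \<nu> x t \<le> t powr (\<nu> - 1) * (exp (- t) * (fact p * t ^ p / x ^ p))"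
        unfolding rho_kernel_def diff_conv_add_uminus[of "-t"] exp_add by (intro mult_left_mono) auto
      also have "\<dots> = fact p / x ^ p * (t powr (\<nu> + real p - 1) * exp (- t))"
        using t by (simp add: powr_diff powr_add powr_realpow field_simps)
      finally show "norm (rho_kernel \<nu> x t) \<le> norm (fact p / x ^ p * (t powr (\<nu> + real p - 1) * exp (- t)))"
        using rho_kernel_nonneg[of \<nu> x t] t assms by simp
    qed
  qed (auto simp: set_borel_measurable_def)
qed

text \<open>The substitution t = sqrt(x) exp(s) makes t + x/t equal to 2 sqrt(x) cosh(s) and turns
  the kernel integral into one over the whole line. Folding it at s = 0 replaces exp(\<nu> s) by 2
  cosh(\<nu> s), which is the integral defining \<open>besselK\<close>.\<close>

lemma rho_integral:
  assumes x: "x > 0"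
  shows "rho \<nu> x = (LINT t:{0<..}|lborel. rho_kernel \<nu> x t)"
proof -
  define r where "r = sqrt x"
  have r: "r > 0" "r * r = x" using x by (auto simp: r_def)
  define h where "h = (\<lambda>s. exp (\<nu> * s) * exp (- 2 * r * cosh s))"
  have img: "(\<lambda>s. r * exp s) ` UNIV = {0<..}"
  proof (intro equalityI subsetI)
    fix y :: real assume "y \<in> {0<..}"
    then have "y = r * exp (ln (y / r))" using r by simp
    then show "y \<in> range (\<lambda>s. r * exp s)" by blast
  qed (use r in auto)
  have inj: "inj (\<lambda>s. r * exp s)" using r by (auto simp: inj_def)
  have der: "((\<lambda>s. r * exp s) has_field_derivative r * exp s) (at s within UNIV)" for s
    by (auto intro!: derivative_eq_intros)
  have abs: "rho_kernel \<nu> x absolutely_integrable_on {0<..}"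
    using rho_kernel_integrable[OF x] absolutely_integrable_on_def
    by (simp add: set_integrable_def integrable_completion)
  have "(\<lambda>s. \<bar>r * exp s\<bar> * rho_kernel \<nu> x (r * exp s)) absolutely_integrable_on UNIV \<and>
           integral UNIV (\<lambda>s. \<bar>r * exp s\<bar> * rho_kernel \<nu> x (r * exp s)) = integral {0<..} (rho_kernel \<nu> x)"
    using has_absolute_integral_change_of_variables_1'[OF _ der inj, of "rho_kernel \<nu> x" "integral {0<..} (rho_kernel \<nu> x)"]
      abs img by simp
  moreover have "\<bar>r * exp s\<bar> * rho_kernel \<nu> x (r * exp s) = x powr (\<nu> / 2) * h s" for s
  proof -
    have e: "- (r * exp s) - x / (r * exp s) = - 2 * r * cosh s"
      using r by (simp add: cosh_def exp_minus field_simps)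
    have "\<bar>r * exp s\<bar> * rho_kernel \<nu> x (r * exp s) = (r * exp s) powr \<nu> * exp (- 2 * r * cosh s)"
      unfolding rho_kernel_def e using r by (simp add: powr_diff)
    also have "(r * exp s) powr \<nu> = x powr (\<nu> / 2) * exp (\<nu> * s)"
      using r x by (simp add: powr_mult r_def powr_half_sqrt[symmetric] powr_powr exp_powr_real mult.commute)
    finally show ?thesis by (simp add: h_def)
  qed
  ultimately have H: "(\<lambda>s. x powr (\<nu> / 2) * h s) absolutely_integrable_on UNIV"
    and HI: "integral UNIV (\<lambda>s. x powr (\<nu> / 2) * h s) = integral {0<..} (rho_kernel \<nu> x)" by simp_all
  have hU: "h absolutely_integrable_on UNIV"
    using absolutely_integrable_scaleR_left[OF H, of "inverse (x powr (\<nu> / 2))"] x by simp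
  have h_meas: "h \<in> borel_measurable borel" unfolding h_def cosh_def by measurable
  have hb: "set_integrable lborel A h" if "A \<in> sets borel" for A
  proof -
    have "integrable lebesgue h" using hU by (simp add: set_integrable_def)
    then have "integrable lborel h" using h_meas by (simp add: integrable_completion)
    then show ?thesis using that unfolding set_integrable_def by (intro integrable_mult_indicator) auto
  qed
  have split: "(LINT s|lborel. h s) = (LINT s:{0..}|lborel. h s) + (LINT s:{..<0}|lborel. h s)"
  proof -
    have "(LINT s|lborel. h s) = (LINT s:{0..} \<union> {..<0}|lborel. h s)"
      unfolding set_lebesgue_integral_def
      by (intro Bochner_Integration.integral_cong) (auto simp: indicator_def)
    also have "\<dots> = (LINT s:{0..}|lborel. h s) + (LINT s:{..<0}|lborel. h s)"
      by (intro set_integral_Un hb) auto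
    finally show ?thesis .
  qed
  have reflect: "(LINT s:{..<0}|lborel. h s) = (LINT s:{0..}|lborel. h (- s))"
  proof -
    have "(LINT s:{..<0}|lborel. h s) = (LINT s:{0<..}|lborel. h (- s))"
      unfolding set_lebesgue_integral_def
      by (subst lborel_integral_real_affine[where c = "-1" and t = 0])
         (auto intro!: Bochner_Integration.integral_cong simp: indicator_def)
    also have "\<dots> = (LINT s:{0..}|lborel. h (- s))"
      unfolding set_lebesgue_integral_def
    proof (rule integral_cong_AE)
      show "AE s in lborel. indicat_real {0<..} s *\<^sub>R h (- s) = indicat_real {0..} s *\<^sub>R h (- s)"
        using AE_lborel_singleton[of "0::real"] by eventually_elim (auto simp: indicator_def)
    qed (use h_meas in auto)
    finally show ?thesis .
  qed
  have hb': "set_integrable lborel {0..} (\<lambda>s. h (- s))"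
  proof -
    have "integrable lborel h" using hb[of UNIV] by (simp add: set_integrable_def)
    then have "integrable lborel (\<lambda>s. h (0 + (-1) * s))"
      by (subst lborel_integrable_real_affine_iff) auto
    then show ?thesis unfolding set_integrable_def by (intro integrable_mult_indicator) auto
  qed
  have "(LINT s|lborel. h s) = (LINT s:{0..}|lborel. h s + h (- s))"
    unfolding split reflect by (rule set_integral_add(2)[symmetric]) (use hb hb' in auto)
  also have "\<dots> = (LINT s:{0..}|lborel. 2 * (exp (- (2 * r) * cosh s) * cosh (\<nu> * s)))"
  proof (intro set_lebesgue_integral_cong allI impI)
    fix s :: real
    have "h s + h (- s) = (exp (\<nu> * s) + exp (- (\<nu> * s))) * exp (- (2 * r) * cosh s)"
      by (simp add: h_def distrib_right)
    also have "exp (\<nu> * s) + exp (- (\<nu> * s)) = 2 * cosh (\<nu> * s)"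
      by (simp add: cosh_def)
    finally show "h s + h (- s) = 2 * (exp (- (2 * r) * cosh s) * cosh (\<nu> * s))"
      by (simp add: mult_ac)
  qed auto
  also have "\<dots> = 2 * besselK \<nu> (2 * r)"
    by (simp add: besselK_def)
  finally have "x powr (\<nu> / 2) * (LINT s|lborel. h s) = rho \<nu> x"
    by (simp add: rho_def r_def)
  moreover have "integral UNIV h = (LINT s|lborel. h s)"
    using set_borel_integral_eq_integral(2)[OF hb[of UNIV]] by (simp add: set_lebesgue_integral_def)
  moreover have "integral UNIV (\<lambda>s. x powr (\<nu> / 2) * h s) = x powr (\<nu> / 2) * integral UNIV h" by simp
  moreover have "integral {0<..} (rho_kernel \<nu> x) = (LINT t:{0<..}|lborel. rho_kernel \<nu> x t)"
    using set_borel_integral_eq_integral(2)[OF rho_kernel_integrable[OF x]] by simp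
  ultimately show ?thesis using HI by simp
qed

lemma rho_pos:
  assumes x: "x > 0"
  shows "rho \<nu> x > 0"
proof -
  have "rho \<nu> x \<ge> 0"
    unfolding rho_integral[OF x] unfolding set_lebesgue_integral_def
    by (intro integral_nonneg_AE AE_I2) (simp add: rho_kernel_nonneg)
  moreover have "rho \<nu> x \<noteq> 0"
  proof
    assume "rho \<nu> x = 0"
    then have "AE t in lborel. indicat_real {0<..} t *\<^sub>R rho_kernel \<nu> x t = 0"
      using integral_nonneg_eq_0_iff_AE[of lborel "\<lambda>t. indicat_real {0<..} t *\<^sub>R rho_kernel \<nu> x t"]
        rho_kernel_integrable[OF x] rho_kernel_nonneg
      unfolding rho_integral[OF x] by (simp add: set_integrable_def set_lebesgue_integral_def)
    then have "AE t in lborel. t \<notin> {0<..<(1::real)}"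
      by eventually_elim (auto simp: rho_kernel_def)
    then have "emeasure lborel {0<..<(1::real)} = 0"
      by (subst (asm) AE_iff_measurable[of "{0<..<1}"]) auto
    then show False by simp
  qed
  ultimately show ?thesis by simp
qed

text \<open>The derivative in t of t^\<nu> exp(-t - x/t) is a combination of the three kernels, and
  this function tends to 0 at both ends: exp(-x/t) forces it at 0 for every \<nu>, exp(-t) at
  infinity.\<close>

lemma rho_recurrence:
  assumes x: "x > 0"
  shows "rho (\<nu> + 1) x = x * rho (\<nu> - 1) x + \<nu> * rho \<nu> x"
proof -
  define F where "F = (\<lambda>t. t powr \<nu> * exp (- t - x / t))"
  define f where "f = (\<lambda>t. \<nu> * rho_kernel \<nu> x t - rho_kernel (\<nu> + 1) x t + x * rho_kernel (\<nu> - 1) x t)"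
  have int: "set_integrable lborel {0<..} f"
    unfolding f_def by (intro set_integral_add set_integral_diff set_integrable_mult_right rho_kernel_integrable x)
  have ein: "einterval 0 \<infinity> = {0<..}"
    by (simp add: zero_ereal_def)
  have "(LBINT t=0..\<infinity>. f t) = 0 - 0"
  proof (rule interval_integral_FTC_integrable)
    fix t :: real assume "0 < ereal t" "ereal t < \<infinity>"
    then have t: "t > 0" by (simp add: zero_ereal_def)
    have "(F has_real_derivative f t) (at t)"
    proof -
      have "(F has_real_derivative \<nu> * t powr (\<nu> - 1) * exp (- t - x / t)
          + exp (- t - x / t) * (- 1 + x / t\<^sup>2) * t powr \<nu>) (at t)"
        unfolding F_def using t
        by (auto intro!: derivative_eq_intros simp: power2_eq_square)
      also have "\<nu> * t powr (\<nu> - 1) * exp (- t - x / t)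
          + exp (- t - x / t) * (- 1 + x / t\<^sup>2) * t powr \<nu> = f t"
        unfolding f_def rho_kernel_def using t
        by (simp add: powr_diff powr_add power2_eq_square) (simp add: field_simps)
      finally show ?thesis .
    qed
    then show "(F has_vector_derivative f t) (at t)"
      by (simp add: has_real_derivative_iff_has_vector_derivative)
    show "isCont f t"
      unfolding f_def rho_kernel_def using t by (intro continuous_intros) auto
  next
    have "((\<lambda>t. F t) \<longlongrightarrow> 0) (at_right 0)"
      unfolding F_def using x by real_asymp
    then show "((F \<circ> real_of_ereal) \<longlongrightarrow> 0) (at_right 0)"
      by (simp add: ereal_tendsto_simps zero_ereal_def)
    have "((\<lambda>t. F t) \<longlongrightarrow> 0) at_top"
      unfolding F_def using x by real_asymp
    then show "((F \<circ> real_of_ereal) \<longlongrightarrow> 0) (at_left \<infinity>)"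
      by (simp add: ereal_tendsto_simps)
  qed (use int ein in auto)
  then have "(LINT t:{0<..}|lborel. f t) = 0"
    by (simp add: interval_lebesgue_integral_def ein)
  moreover have "(LINT t:{0<..}|lborel. f t) = \<nu> * rho \<nu> x - rho (\<nu> + 1) x + x * rho (\<nu> - 1) x"
    unfolding f_def rho_integral[OF x]
    by (simp add: set_integral_add set_integral_diff set_integrable_mult_right rho_kernel_integrable x)
  ultimately show ?thesis by simp
qed

text \<open>A second-order Taylor estimate, uniform in the integration variable; it replaces differentiation
  under the integral sign.\<close>
lemma rho_increment_bound:
  assumes x: "x > 0" and h: "\<bar>h\<bar> \<le> x / 2"
  shows "\<bar>rho \<nu> (x + h) - rho \<nu> x + h * rho (\<nu> - 1) x\<bar> \<le> h\<^sup>2 * rho (\<nu> - 2) (x / 2)"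
proof -
  have xh: "x + h > 0" "x / 2 > 0" using x h by (auto simp: abs_le_iff)
  define f where "f = (\<lambda>t. rho_kernel \<nu> (x + h) t - rho_kernel \<nu> x t + h * rho_kernel (\<nu> - 1) x t)"
  have fI: "set_integrable lborel {0<..} f"
    unfolding f_def by (intro set_integral_add set_integral_diff set_integrable_mult_right rho_kernel_integrable x xh)
  have bound: "\<bar>f t\<bar> \<le> h\<^sup>2 * rho_kernel (\<nu> - 2) (x / 2) t" if t: "t > 0" for t
  proof -
    obtain s where s: "\<bar>s\<bar> \<le> \<bar>- h / t\<bar>" and e: "exp (- h / t) = (\<Sum>m<2. (- h / t) ^ m / fact m) + exp s / fact 2 * (- h / t)\<^sup>2"
      using Maclaurin_exp_le[of "- h / t" 2] by blast
    have e': "exp (- h / t) - 1 + h / t = exp s / 2 * (h / t)\<^sup>2"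
      unfolding e by (simp add: lessThan_nat_numeral lessThan_Suc power_divide eval_nat_numeral)
    \<comment> \<open>The Taylor remainder contributes exp(s) with |s| at most |h|/t. The condition
      |h| <= x/2 lets it consume at most half of the decay exp(-x/t), hence the argument x/2 in the
      bound; the factor (h/t)^2 lowers the order to \<nu> - 2.\<close>
    have s': "s - x / t \<le> - (x / 2) / t"
    proof -
      have "\<bar>- h / t\<bar> \<le> (x / 2) / t" using divide_right_mono[OF h, of t] t by (simp add: abs_divide)
      with s have "s \<le> (x / 2) / t" by linarith
      then show ?thesis by (simp add: field_simps)
    qed
    have "f t = t powr (\<nu> - 1) * exp (- t - x / t) * (exp (- h / t) - 1 + h / t)"
    proof -
      have "exp (- t - (x + h) / t) = exp (- t - x / t) * exp (- h / t)"
        by (simp add: add_divide_distrib flip: exp_add)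
      moreover have "t powr (\<nu> - 1 - 1) = t powr (\<nu> - 1) / t" using t by (subst powr_diff) simp
      ultimately show ?thesis by (simp add: f_def rho_kernel_def algebra_simps)
    qed
    also have "\<dots> = h\<^sup>2 * (t powr (\<nu> - 2 - 1) * exp (- t) * (exp (s - x / t) / 2))"
    proof -
      have p: "t powr (\<nu> - 2 - 1) = t powr (\<nu> - 1) / t\<^sup>2" using t powr_diff[of t "\<nu> - 1" 2] by (simp add: algebra_simps)
      have q: "exp (- t - x / t) = exp (- t) * exp (- x / t)" "exp (s - x / t) = exp s * exp (- x / t)"
        by (simp_all flip: exp_add)
      show ?thesis unfolding e' p q by (simp add: power_divide mult_ac)
    qed
    finally have ft: "f t = h\<^sup>2 * (t powr (\<nu> - 2 - 1) * exp (- t) * (exp (s - x / t) / 2))" .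
    have "exp (s - x / t) / 2 \<le> exp (- (x / 2) / t)"
    proof -
      have "exp (s - x / t) \<le> exp (- (x / 2) / t)" using s' by simp
      moreover have "exp (s - x / t) > 0" by simp
      ultimately show ?thesis by linarith
    qed
    then have "h\<^sup>2 * (t powr (\<nu> - 2 - 1) * exp (- t) * (exp (s - x / t) / 2))
        \<le> h\<^sup>2 * (t powr (\<nu> - 2 - 1) * exp (- t) * exp (- (x / 2) / t))"
      by (intro mult_left_mono) auto
    also have "\<dots> = h\<^sup>2 * rho_kernel (\<nu> - 2) (x / 2) t"
      by (simp add: rho_kernel_def mult.assoc flip: exp_add)
    finally show ?thesis unfolding ft by simp
  qed
  have "rho \<nu> (x + h) - rho \<nu> x + h * rho (\<nu> - 1) x = (LINT t:{0<..}|lborel. f t)"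
    unfolding f_def rho_integral[OF x] rho_integral[OF xh(1)]
    by (simp add: set_integral_add set_integral_diff set_integrable_mult_right rho_kernel_integrable x xh)
  also have "\<bar>\<dots>\<bar> \<le> (LINT t:{0<..}|lborel. \<bar>f t\<bar>)"
    using set_integral_norm_bound[OF fI] by simp
  also have "\<dots> \<le> (LINT t:{0<..}|lborel. h\<^sup>2 * rho_kernel (\<nu> - 2) (x / 2) t)"
    using fI xh by (intro set_integral_mono set_integrable_abs set_integrable_mult_right rho_kernel_integrable bound) auto
  also have "\<dots> = h\<^sup>2 * rho (\<nu> - 2) (x / 2)"
    by (simp add: rho_integral[OF xh(2)])
  finally show ?thesis .
qed

lemma DERIV_rho:
  assumes x: "x > 0"
  shows "(rho \<nu> has_real_derivative - rho (\<nu> - 1) x) (at x)"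
  unfolding DERIV_def
proof (rule LIM_zero_cancel, rule Lim_null_comparison)
  show "((\<lambda>h. \<bar>h\<bar> * rho (\<nu> - 2) (x / 2)) \<longlongrightarrow> 0) (at 0)"
    by (auto intro!: tendsto_eq_intros)
  have "eventually (\<lambda>h. \<bar>h\<bar> < x / 2 \<and> h \<noteq> 0) (at (0::real))"
    using x unfolding eventually_at by (intro exI[of _ "x / 2"]) auto
  then show "\<forall>\<^sub>F h in at 0. norm ((rho \<nu> (x + h) - rho \<nu> x) / h - - rho (\<nu> - 1) x) \<le> \<bar>h\<bar> * rho (\<nu> - 2) (x / 2)"
  proof eventually_elim
    case (elim h)
    have "(rho \<nu> (x + h) - rho \<nu> x) / h - - rho (\<nu> - 1) x = (rho \<nu> (x + h) - rho \<nu> x + h * rho (\<nu> - 1) x) / h"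
      using elim by (simp add: field_simps)
    also have "norm \<dots> \<le> h\<^sup>2 * rho (\<nu> - 2) (x / 2) / \<bar>h\<bar>"
      using rho_increment_bound[OF x, of h \<nu>] elim by (simp add: divide_right_mono)
    also have "\<dots> = \<bar>h\<bar> * rho (\<nu> - 2) (x / 2)"
      proof -
      have "h\<^sup>2 = \<bar>h\<bar> * \<bar>h\<bar>" by (simp add: power2_eq_square)
      then show ?thesis using elim by (simp del: abs_mult_self_eq)
    qed
    finally show ?case .
  qed
qed

text \<open>Integrate the nonnegative function $(t - c)^2$ against the kernel, with the optimal $c$.\<close>
lemma rho_turan:
  assumes x: "x > 0"
  shows "(rho \<nu> x)\<^sup>2 \<le> rho (\<nu> - 1) x * rho (\<nu> + 1) x"
proof -
  define c where "c = rho \<nu> x / rho (\<nu> - 1) x"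
  have "0 \<le> (LINT t:{0<..}|lborel. rho_kernel (\<nu> + 1) x t - 2 * c * rho_kernel \<nu> x t + c\<^sup>2 * rho_kernel (\<nu> - 1) x t)"
    unfolding set_lebesgue_integral_def
  proof (intro integral_nonneg_AE AE_I2)
    fix t :: real
    show "0 \<le> indicator {0<..} t *\<^sub>R (rho_kernel (\<nu> + 1) x t - 2 * c * rho_kernel \<nu> x t + c\<^sup>2 * rho_kernel (\<nu> - 1) x t)"
    proof (cases "t > 0")
      case True
      then have "rho_kernel (\<nu> + 1) x t = rho_kernel (\<nu> - 1) x t * t\<^sup>2" "rho_kernel \<nu> x t = rho_kernel (\<nu> - 1) x t * t"
        by (simp_all add: rho_kernel_def powr_diff power2_eq_square)
      then have "rho_kernel (\<nu> + 1) x t - 2 * c * rho_kernel \<nu> x t + c\<^sup>2 * rho_kernel (\<nu> - 1) x t = rho_kernel (\<nu> - 1) x t * (t - c)\<^sup>2"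
        by (simp add: power2_eq_square algebra_simps)
      then show ?thesis using rho_kernel_nonneg by simp
    qed simp
  qed
  also have "\<dots> = rho (\<nu> + 1) x - 2 * c * rho \<nu> x + c\<^sup>2 * rho (\<nu> - 1) x"
    unfolding rho_integral[OF x]
    by (simp add: set_integral_add set_integral_diff set_integrable_mult_right rho_kernel_integrable x)
  finally show ?thesis
    using rho_pos[OF x, of "\<nu> - 1"] by (simp add: c_def field_simps power2_eq_square)
qed

text \<open>All integrands are nonnegative, so the order of integration may be exchanged. For fixed
  t the substitution x = t y gives Gamma(s) t^(s+\<nu>-1) exp(-t), and the outer integral is again a
  Gamma integral.\<close>

lemma rho_Mellin:
  fixes s \<nu> :: real
  assumes s: "s > 0" "s + \<nu> > 0"
  shows "set_integrable lborel {0<..} (\<lambda>x. x powr (s - 1) * rho \<nu> x)"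
    and "(LINT x:{0<..}|lborel. x powr (s - 1) * rho \<nu> x) = Gamma s * Gamma (s + \<nu>)"
proof -
  define g where "g = (\<lambda>x t. indicat_real {0<..} x * indicat_real {0<..} t * (x powr (s - 1) * rho_kernel \<nu> x t))"
  have g_nonneg: "g x t \<ge> 0" for x t by (simp add: g_def rho_kernel_nonneg)
  have g_meas: "case_prod g \<in> borel_measurable (lborel \<Otimes>\<^sub>M lborel)"
    unfolding g_def rho_kernel_def by measurable
  define f where "f = (\<lambda>x. indicat_real {0<..} x * (x powr (s - 1) * rho \<nu> x))"
  have f_eq: "f x = (LINT t|lborel. g x t)" for x
  proof (cases "x > 0")
    case True
    have "(LINT t|lborel. g x t) = (LINT t|lborel. x powr (s - 1) * (indicat_real {0<..} t *\<^sub>R rho_kernel \<nu> x t))"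
      using True by (intro Bochner_Integration.integral_cong) (auto simp: g_def)
    also have "\<dots> = f x" using True by (simp add: f_def rho_integral[OF True] set_lebesgue_integral_def)
    finally show ?thesis by simp
  qed (simp add: f_def g_def)
  have g_int: "integrable lborel (g x)" for x
  proof (cases "x > 0")
    case True
    have "g x = (\<lambda>t. x powr (s - 1) * (indicat_real {0<..} t *\<^sub>R rho_kernel \<nu> x t))"
      using True by (auto simp: g_def)
    then show ?thesis using rho_kernel_integrable[OF True, of \<nu>] by (simp add: set_integrable_def)
  qed (simp add: g_def)
  have f_meas: "f \<in> borel_measurable lborel"
    unfolding f_eq[abs_def] using g_meas by (rule lborel.borel_measurable_lebesgue_integral)
  have inner: "(\<integral>\<^sup>+x. ennreal (g x t) \<partial>lborel)
      = ennreal (Gamma s) * ennreal (indicat_real {0<..} t * (t powr (s + \<nu> - 1) * exp (- t)))" for t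
  proof (cases "t > 0")
    case True
    have "(\<integral>\<^sup>+x. ennreal (g x t) \<partial>lborel) = ennreal \<bar>t\<bar> * (\<integral>\<^sup>+y. ennreal (g (0 + t * y) t) \<partial>lborel)"
      by (rule nn_integral_real_affine) (use True in \<open>auto simp: g_def rho_kernel_def\<close>)
    also have "\<dots> = (\<integral>\<^sup>+y. ennreal \<bar>t\<bar> * ennreal (g (0 + t * y) t) \<partial>lborel)"
      by (rule nn_integral_cmult[symmetric]) (unfold g_def rho_kernel_def, measurable)
    also have "\<dots> = (\<integral>\<^sup>+y. ennreal (t powr (s + \<nu> - 1) * exp (- t)) *
         ennreal (indicat_real {0<..} y * (y powr (s - 1) * exp (- y))) \<partial>lborel)"
    proof (rule nn_integral_cong)
      fix y :: real
      have "t * (indicat_real {0<..} (t * y) * indicat_real {0<..} t * ((t * y) powr (s - 1) * rho_kernel \<nu> (t * y) t))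
        = t powr (s + \<nu> - 1) * exp (- t) * (indicat_real {0<..} y * (y powr (s - 1) * exp (- y)))"
      proof (cases "y > 0")
        case y: True
        have "exp (- t - t * y / t) = exp (- t) * exp (- y)" using True by (simp flip: exp_add)
        moreover have "t * ((t * y) powr (s - 1) * t powr (\<nu> - 1)) = t powr (s + \<nu> - 1) * y powr (s - 1)"
          using True y by (simp add: powr_mult powr_diff powr_add field_simps)
        ultimately show ?thesis using True y by (simp add: rho_kernel_def mult_ac)
      qed (use True in \<open>simp add: zero_less_mult_iff\<close>)
      then show "ennreal \<bar>t\<bar> * ennreal (g (0 + t * y) t) =
           ennreal (t powr (s + \<nu> - 1) * exp (- t)) * ennreal (indicat_real {0<..} y * (y powr (s - 1) * exp (- y)))"
        using True by (simp add: g_def flip: ennreal_mult')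
    qed
    also have "\<dots> = ennreal (t powr (s + \<nu> - 1) * exp (- t)) * ennreal (Gamma s)"
      by (subst nn_integral_cmult) (auto simp: nn_integral_Gamma[OF s(1)])
    finally show ?thesis using True by (simp add: mult.commute)
  qed (simp add: g_def)
  have "(\<integral>\<^sup>+x. ennreal (f x) \<partial>lborel) = (\<integral>\<^sup>+x. (\<integral>\<^sup>+t. ennreal (g x t) \<partial>lborel) \<partial>lborel)"
    by (intro nn_integral_cong) (simp add: f_eq nn_integral_eq_integral g_int g_nonneg)
  also have "\<dots> = (\<integral>\<^sup>+t. (\<integral>\<^sup>+x. ennreal (g x t) \<partial>lborel) \<partial>lborel)"
    using g_meas by (intro lborel_pair.Fubini'[symmetric]) simp
  also have "\<dots> = ennreal (Gamma s) * ennreal (Gamma (s + \<nu>))"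
    unfolding inner by (subst nn_integral_cmult) (auto simp: nn_integral_Gamma[OF s(2)])
  also have "\<dots> = ennreal (Gamma s * Gamma (s + \<nu>))"
    using Gamma_real_pos[OF s(1)] by (simp add: ennreal_mult')
  finally have nn: "(\<integral>\<^sup>+x. ennreal (f x) \<partial>lborel) = ennreal (Gamma s * Gamma (s + \<nu>))" .
  have "f x \<ge> 0" for x unfolding f_eq by (intro integral_nonneg_AE AE_I2 g_nonneg)
  then have "has_bochner_integral lborel f (Gamma s * Gamma (s + \<nu>))"
    using Gamma_real_pos[OF s(1)] Gamma_real_pos[OF s(2)]
    by (intro has_bochner_integral_nn_integral nn f_meas) auto
  then show "set_integrable lborel {0<..} (\<lambda>x. x powr (s - 1) * rho \<nu> x)"
    and "(LINT x:{0<..}|lborel. x powr (s - 1) * rho \<nu> x) = Gamma s * Gamma (s + \<nu>)"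
    by (auto simp: f_def set_integrable_def set_lebesgue_integral_def has_bochner_integral_iff)
qed

section \<open>Independence of \<open>rho \<nu>\<close> and \<open>rho (\<nu> + 1)\<close> over
  polynomials\<close>

lemma lead_coeff_nonneg:
  fixes p :: "real poly"
  assumes "\<And>x. x > 0 \<Longrightarrow> poly p x \<ge> 0"
  shows "lead_coeff p \<ge> 0"
proof (rule ccontr)
  assume "\<not> lead_coeff p \<ge> 0"
  then have neg: "0 < lead_coeff (- p)" by simp
  from poly_pinfty_gt_lc[OF this] obtain n where n: "\<And>x. x \<ge> n \<Longrightarrow> poly (- p) x \<ge> lead_coeff (- p)"
    by auto
  have "poly (- p) (max n 1) > 0" using n[of "max n 1"] neg by linarith
  moreover have "poly p (max n 1) \<ge> 0" by (rule assms) simp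
  ultimately show False by simp
qed

text \<open>The recurrence eliminates the outer orders from the Turan inequality. At order \<nu>
  this gives the lower bound, where \<nu> >= 0 makes the term -\<nu> a b disposable; at order \<nu>
  + 1 it gives b^2 <= x a^2 + (\<nu>+1) a b, whose mixed term is absorbed by 2uv <= u^2 +
  v^2.\<close>

lemma rho_ratio_bounds:
  assumes x: "x > 0" and \<nu>: "\<nu> \<ge> 0"
  shows "x * (rho \<nu> x)\<^sup>2 \<le> (rho (\<nu> + 1) x)\<^sup>2"
    and "(rho (\<nu> + 1) x)\<^sup>2 \<le> (2 * x + (\<nu> + 1)\<^sup>2) * (rho \<nu> x)\<^sup>2"
proof -
  define a b where "a = rho \<nu> x" and "b = rho (\<nu> + 1) x"
  have pos: "a > 0" "b > 0" using rho_pos[OF x] by (auto simp: a_def b_def)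
  have "x * a\<^sup>2 \<le> x * (rho (\<nu> - 1) x * b)"
    using rho_turan[OF x, of \<nu>] x by (simp add: a_def b_def)
  also have "\<dots> = (b - \<nu> * a) * b"
    using rho_recurrence[OF x, of \<nu>] by (simp add: a_def b_def algebra_simps)
  also have "\<dots> \<le> b\<^sup>2"
    using pos \<nu> by (simp add: power2_eq_square algebra_simps)
  finally show "x * (rho \<nu> x)\<^sup>2 \<le> (rho (\<nu> + 1) x)\<^sup>2" by (simp add: a_def b_def)
  have "b\<^sup>2 \<le> a * (x * a + (\<nu> + 1) * b)"
    using rho_turan[OF x, of "\<nu> + 1"] rho_recurrence[OF x, of "\<nu> + 1"] by (simp add: a_def b_def)
  moreover have "2 * ((\<nu> + 1) * a * b) \<le> b\<^sup>2 + ((\<nu> + 1) * a)\<^sup>2"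
    using sum_squares_bound[of "(\<nu> + 1) * a" b] by (simp add: algebra_simps)
  ultimately have "b\<^sup>2 \<le> (2 * x + (\<nu> + 1)\<^sup>2) * a\<^sup>2"
    by (simp add: algebra_simps power2_eq_square)
  then show "(rho (\<nu> + 1) x)\<^sup>2 \<le> (2 * x + (\<nu> + 1)\<^sup>2) * (rho \<nu> x)\<^sup>2" by (simp add: a_def b_def)
qed

lemma rho_linear_independent:
  assumes \<nu>: "\<nu> \<ge> 0"
    and eq: "\<And>x. x > 0 \<Longrightarrow> poly p x * rho \<nu> x + poly q x * rho (\<nu> + 1) x = 0"
  shows "p = 0"
proof -
  \<comment> \<open>$x q^2 \le p^2 \le (2x+(\nu+1)^2) q^2$ is impossible for $q \ne 0$: the degree of $p^2$ is even,
    that of $x q^2$ is odd.\<close>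
  have sq: "(poly p x)\<^sup>2 * (rho \<nu> x)\<^sup>2 = (poly q x)\<^sup>2 * (rho (\<nu> + 1) x)\<^sup>2" if "x > 0" for x
  proof -
    have "poly p x * rho \<nu> x = - (poly q x * rho (\<nu> + 1) x)" using eq[OF that] by linarith
    then have "(poly p x * rho \<nu> x)\<^sup>2 = (poly q x * rho (\<nu> + 1) x)\<^sup>2" by (simp only: power2_minus)
    then show ?thesis by (simp add: power_mult_distrib)
  qed
  have lower: "x * (poly q x)\<^sup>2 \<le> (poly p x)\<^sup>2" if "x > 0" for x
  proof -
    have "x * (poly q x)\<^sup>2 * (rho \<nu> x)\<^sup>2 \<le> (poly p x)\<^sup>2 * (rho \<nu> x)\<^sup>2"
      using mult_left_mono[OF rho_ratio_bounds(1)[OF that \<nu>], of "(poly q x)\<^sup>2"] sq[OF that] by (simp add: mult_ac)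
    then show ?thesis using rho_pos[OF that, of \<nu>] by simp
  qed
  have upper: "(poly p x)\<^sup>2 \<le> (2 * x + (\<nu> + 1)\<^sup>2) * (poly q x)\<^sup>2" if "x > 0" for x
  proof -
    have "(poly p x)\<^sup>2 * (rho \<nu> x)\<^sup>2 \<le> (2 * x + (\<nu> + 1)\<^sup>2) * (poly q x)\<^sup>2 * (rho \<nu> x)\<^sup>2"
      using mult_left_mono[OF rho_ratio_bounds(2)[OF that \<nu>], of "(poly q x)\<^sup>2"] sq[OF that] by (simp add: mult_ac)
    then show ?thesis using rho_pos[OF that, of \<nu>] by simp
  qed
  show ?thesis
  proof (cases "q = 0")
    case True
    then have "{0<..} \<subseteq> {x. poly p x = 0}" using upper by auto
    then have "infinite {x. poly p x = 0}" using infinite_Ioi infinite_super by blast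
    then show ?thesis using poly_roots_finite by blast
  next
    case q: False
    define A where "A = [:0, 1:] * (q * q)"
    define B where "B = [:(\<nu> + 1)\<^sup>2, 2:] * (q * q)"
    have deg: "degree A = 2 * degree q + 1" "degree B = 2 * degree q + 1"
      using q by (simp_all add: A_def B_def degree_mult_eq del: mult_pCons_left)
    have lc: "lead_coeff A > 0" "lead_coeff B > 0"
    proof -
      have "lead_coeff q * lead_coeff q > 0"
        using q by (metis leading_coeff_0_iff not_real_square_gt_zero)
      then show "lead_coeff A > 0" "lead_coeff B > 0"
        by (simp_all add: A_def B_def lead_coeff_mult del: mult_pCons_left)
    qed
    have "lead_coeff (p * p + - A) \<ge> 0"
      using lower by (intro lead_coeff_nonneg) (simp add: A_def power2_eq_square algebra_simps)
    then have "\<not> degree (p * p) < degree A"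
      using lead_coeff_add_le[of "p * p" "- A"] lc by auto
    moreover have "degree (p * p) \<noteq> degree A"
    proof (cases "p = 0")
      case False
      then have "degree (p * p) = 2 * degree p" by (simp add: degree_mult_eq)
      then show ?thesis unfolding deg by presburger
    qed (simp add: deg)
    moreover have "\<not> degree B < degree (p * p)"
    proof
      assume less: "degree B < degree (p * p)"
      have "lead_coeff (B + - (p * p)) \<ge> 0"
        using upper by (intro lead_coeff_nonneg) (simp add: B_def power2_eq_square algebra_simps)
      moreover have "lead_coeff (B + - (p * p)) = - lead_coeff (p * p)"
        using lead_coeff_add_le[of B "- (p * p)"] less by simp
      moreover have "lead_coeff (p * p) > 0"
      proof -
        have "p \<noteq> 0" using less by auto
        then have "lead_coeff p * lead_coeff p > 0"
          by (metis leading_coeff_0_iff not_real_square_gt_zero)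
        then show ?thesis by (simp add: lead_coeff_mult)
      qed
      ultimately show False by simp
    qed
    ultimately show ?thesis using deg by linarith
  qed
qed

section \<open>Iterated derivatives\<close>

text \<open>Closed form of $\frac{d^p}{dy^p}[y^{b+p}\rho_\nu(y)]$.\<close>
definition rodr :: "real \<Rightarrow> nat \<Rightarrow> real \<Rightarrow> real \<Rightarrow> real" where
  "rodr \<nu> p b y = (\<Sum>m\<le>p. real (p choose m) * pochhammer (b + real m + 1) (p - m) * (-1) ^ m
       * (y powr (b + real m) * rho (\<nu> - real m) y))"

lemma rodr_eq:
  assumes "y > 0"
  shows "rodr \<nu> p b y = y powr b * (\<Sum>m\<le>p. real (p choose m) * pochhammer (b + real m + 1) (p - m) * (-1) ^ m
       * (y ^ m * rho (\<nu> - real m) y))"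
  using assms by (simp add: rodr_def sum_distrib_left powr_add powr_realpow mult_ac)

text \<open>One differentiation raises the order p and lowers b by one, because the power b + p
  under the derivative stays fixed. The coefficients follow from Pascal's rule after extending one
  sum by a vanishing term.\<close>

lemma DERIV_rodr:
  assumes y: "y > 0"
  shows "(rodr \<nu> p (b + 1) has_real_derivative rodr \<nu> (Suc p) b y) (at y)"
proof -
  define u where "u = (\<lambda>m. y powr (b + real m) * rho (\<nu> - real m) y)"
  define K where "K = (\<lambda>m. pochhammer (b + real m + 2) (p - m) * (-1) ^ Suc m)"
  have d: "((\<lambda>y. y powr (b + 1 + real m) * rho (\<nu> - real m) y) has_real_derivative
      (b + 1 + real m) * u m - u (Suc m)) (at y)" for m
    by (rule derivative_eq_intros DERIV_rho y refl)+ (use y in \<open>simp add: u_def algebra_simps\<close>)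
  have "(rodr \<nu> p (b + 1) has_real_derivative
      (\<Sum>m\<le>p. real (p choose m) * pochhammer (b + 1 + real m + 1) (p - m) * (-1) ^ m * ((b + 1 + real m) * u m - u (Suc m)))) (at y)"
    unfolding rodr_def[abs_def] by (intro DERIV_sum DERIV_cmult d)
  also have "(\<Sum>m\<le>p. real (p choose m) * pochhammer (b + 1 + real m + 1) (p - m) * (-1) ^ m * ((b + 1 + real m) * u m - u (Suc m)))
     = (\<Sum>m\<le>p. real (p choose m) * pochhammer (b + real m + 1) (Suc p - m) * (-1) ^ m * u m)
       + (\<Sum>m\<le>p. real (p choose m) * (K m * u (Suc m)))"
    unfolding sum.distrib[symmetric]
    by (intro sum.cong refl) (auto simp: K_def Suc_diff_le pochhammer_rec algebra_simps)
  also have "(\<Sum>m\<le>p. real (p choose m) * pochhammer (b + real m + 1) (Suc p - m) * (-1) ^ m * u m)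
     = (\<Sum>m\<le>Suc p. real (p choose m) * pochhammer (b + real m + 1) (Suc p - m) * (-1) ^ m * u m)"
    by simp
  also have "\<dots> = pochhammer (b + 1) (Suc p) * u 0 + (\<Sum>m\<le>p. real (p choose Suc m) * (K m * u (Suc m)))"
    by (subst sum.atMost_Suc_shift) (simp add: K_def algebra_simps)
  also have "\<dots> + (\<Sum>m\<le>p. real (p choose m) * (K m * u (Suc m)))
     = pochhammer (b + 1) (Suc p) * u 0 + (\<Sum>m\<le>p. real (Suc p choose Suc m) * (K m * u (Suc m)))"
    by (simp add: sum.distrib algebra_simps)
  also have "\<dots> = rodr \<nu> (Suc p) b y"
    unfolding rodr_def by (subst sum.atMost_Suc_shift) (simp add: K_def u_def algebra_simps)
  finally show ?thesis .
qed

text \<open>A derivative at x depends on values near x, so each iterate must be known on the whole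
  open half-line before the next step. Agreement for y > 0 is enough; the values of \<open>f\<close>
  elsewhere are arbitrary.\<close>

lemma higher_deriv_eq:
  fixes f :: "real \<Rightarrow> real"
  assumes "\<And>y. y > 0 \<Longrightarrow> f y = g 0 y"
    and "\<And>i y. i < n \<Longrightarrow> y > 0 \<Longrightarrow> (g i has_real_derivative g (Suc i) y) (at y)"
    and "x > 0"
  shows "(deriv ^^ n) f x = g n x"
proof -
  have "\<forall>x>0. (deriv ^^ k) f x = g k x" if "k \<le> n" for k
    using that
  proof (induction k)
    case (Suc k)
    show ?case
    proof (intro allI impI)
      fix x :: real assume x: "x > 0"
      have "((deriv ^^ k) f has_real_derivative g (Suc k) x) (at x)"
        using Suc x by (intro has_field_derivative_transform_within_open[OF assms(2)[of k x], where S = "{0<..}"]) auto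
      then show "(deriv ^^ Suc k) f x = g (Suc k) x" by (simp add: DERIV_imp_deriv)
    qed
  qed (use assms in auto)
  then show ?thesis using assms(3) by blast
qed

lemma rho_shift_down:
  assumes "x > 0"
  shows "x ^ m * rho (\<nu> - real m) x = poly (bessel_poly m \<nu>) x * rho \<nu> x + poly (bessel_poly' m \<nu>) x * rho (\<nu> + 1) x"
  by (rule shift_down_bessel_poly[of "\<lambda>\<mu>. rho \<mu> x"]) (rule rho_recurrence[OF assms])

text \<open>\<open>vandermonde_binomial\<close> is used from right to left, with a = b + \<nu> and
  \<nu> as second base: each coefficient of the Leibniz sum is opened into a sum over k. Then each
  y^m rho_(\<nu>-m) is reduced to the two basic orders.\<close>

lemma rodr_bessel_poly:
  assumes y: "y > 0"
  shows "rodr \<nu> j b y = y powr b *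
    (rho \<nu> y * (\<Sum>k\<le>j. \<Sum>m\<le>k. (-1) ^ k * pochhammer (b + \<nu> + real k + 1) (j - k) * pochhammer \<nu> (k - m)
          * real (j choose k) * real (k choose m) * poly (bessel_poly m \<nu>) y)
     + rho (\<nu> + 1) y * (\<Sum>k\<le>j. \<Sum>m<k. (-1) ^ k * pochhammer (b + \<nu> + real k + 1) (j - k) * pochhammer \<nu> (k - m - 1)
          * real (j choose k) * real (k choose (m + 1)) * poly (bessel_poly m (\<nu> - 1)) y))"
proof -
  define v where "v = (\<lambda>m. y ^ m * rho (\<nu> - real m) y)"
  define w where "w = (\<lambda>k m. (-1) ^ k * pochhammer (b + \<nu> + real k + 1) (j - k) * pochhammer \<nu> (k - m) * real (j choose k) * real (k choose m))"
  have "(\<Sum>m\<le>j. real (j choose m) * pochhammer (b + real m + 1) (j - m) * (-1) ^ m * v m)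
     = (\<Sum>m\<le>j. (\<Sum>k\<le>j. real (j choose k) * real (k choose m) * (-1) ^ k
            * pochhammer (b + \<nu> + real k + 1) (j - k) * pochhammer \<nu> (k - m)) * v m)"
    unfolding vandermonde_binomial by (simp add: mult_ac)
  also have "\<dots> = (\<Sum>m\<le>j. \<Sum>k\<le>j. w k m * v m)"
    by (simp add: sum_distrib_left sum_distrib_right w_def mult_ac)
  also have "\<dots> = (\<Sum>k\<le>j. \<Sum>m\<le>j. w k m * v m)"
    by (rule sum.swap)
  also have "\<dots> = (\<Sum>k\<le>j. \<Sum>m\<le>k. w k m * v m)"
    by (intro sum.cong refl sum.mono_neutral_right) (auto simp: w_def)
  also have "\<dots> = (\<Sum>k\<le>j. (rho \<nu> y * (\<Sum>m\<le>k. w k m * poly (bessel_poly m \<nu>) y))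
      + rho (\<nu> + 1) y * (\<Sum>m\<le>k. w k m * poly (bessel_poly' m \<nu>) y))"
    unfolding v_def rho_shift_down[OF y] by (simp add: algebra_simps sum.distrib sum_distrib_left)
  also have "\<dots> = rho \<nu> y * (\<Sum>k\<le>j. \<Sum>m\<le>k. w k m * poly (bessel_poly m \<nu>) y)
      + rho (\<nu> + 1) y * (\<Sum>k\<le>j. \<Sum>m\<le>k. w k m * poly (bessel_poly' m \<nu>) y)"
    by (simp add: sum.distrib sum_distrib_left)
  \<comment> \<open>The m = 0 term vanishes because \<open>bessel_poly' 0\<close> is 0. Renaming m
    to m + 1 explains the range m < k and the shifted entries \<open>k - m - 1\<close> and
    \<open>k choose (m + 1)\<close> of \<open>rod_S2\<close>.\<close>
  also have "(\<Sum>k\<le>j. \<Sum>m\<le>k. w k m * poly (bessel_poly' m \<nu>) y)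
      = (\<Sum>k\<le>j. \<Sum>m<k. w k (m + 1) * poly (bessel_poly m (\<nu> - 1)) y)"
  proof (rule sum.cong[OF refl])
    fix k
    show "(\<Sum>m\<le>k. w k m * poly (bessel_poly' m \<nu>) y) = (\<Sum>m<k. w k (m + 1) * poly (bessel_poly m (\<nu> - 1)) y)"
      unfolding lessThan_Suc_atMost[symmetric] by (subst sum.lessThan_Suc_shift) (simp add: bessel_poly'_def)
  qed
  finally show ?thesis
    unfolding rodr_eq[OF y] v_def w_def by simp
qed

text \<open>The coefficient of \<open>rho \<nu>\<close> in x^(-\<alpha>) d^k/dx^k
  [x^(k+\<alpha>) rho_\<nu>(x)] once every order is reduced to \<nu> and \<nu> + 1.\<close>

definition rodr_poly :: "real \<Rightarrow> real \<Rightarrow> nat \<Rightarrow> real poly" where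
  "rodr_poly \<nu> \<alpha> k = (\<Sum>m\<le>k. smult (real (k choose m) * pochhammer (\<alpha> + real m + 1) (k - m) * (-1) ^ m) (bessel_poly m \<nu>))"

text \<open>Collecting the coefficient of x^i leaves a sum over m >= 2i. With m = 2i + s its terms
  are hypergeometric in s, and \<alpha> > -1 keeps the denominators away from 0.\<close>

lemma rodr_poly_hyp3F2:
  assumes \<alpha>: "\<alpha> > -1"
  shows "poly (rodr_poly \<nu> \<alpha> k) x = pochhammer (\<alpha> + 1) k *
     (\<Sum>i\<le>k div 2. real (k choose (2 * i)) * x ^ i / pochhammer (\<alpha> + 1) (2 * i) *
        hyp3F2 (- real (k - 2 * i)) (real i - \<nu>) (real i + 1) (2 * real i + 1 + \<alpha>) (2 * real i + 1) 1)"
proof -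
  have pp: "pochhammer (\<alpha> + real m + 1) n > 0" for m n
    using \<alpha> by (intro pochhammer_pos) linarith
  \<comment> \<open>No sign appears here: the (-1)^m of \<open>rodr_poly\<close> cancels the one in
    \<open>poly_bessel_poly_choose\<close>.\<close>
  define c where "c = (\<lambda>m i. real (k choose m) * pochhammer (\<alpha> + real m + 1) (k - m)
     * (real ((m - i) choose i) * pochhammer (\<nu> + real i - real m + 1) (m - 2 * i)))"
  have "poly (rodr_poly \<nu> \<alpha> k) x = (\<Sum>m\<le>k. \<Sum>i\<le>k. c m i * x ^ i)"
    unfolding rodr_poly_def poly_sum poly_smult
    by (intro sum.cong refl) (simp add: poly_bessel_poly_choose[where N = k] c_def sum_distrib_left mult_ac flip: power_mult_distrib)
  also have "\<dots> = (\<Sum>i\<le>k. (\<Sum>m\<le>k. c m i) * x ^ i)"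
    by (subst sum.swap) (simp add: sum_distrib_right)
  also have "\<dots> = (\<Sum>i\<le>k div 2. (\<Sum>m\<le>k. c m i) * x ^ i)"
    by (intro sum.mono_neutral_right) (auto simp: c_def intro!: sum.neutral)
  also have "\<dots> = (\<Sum>i\<le>k div 2. pochhammer (\<alpha> + 1) k * (real (k choose (2 * i)) * x ^ i / pochhammer (\<alpha> + 1) (2 * i) *
        hyp3F2 (- real (k - 2 * i)) (real i - \<nu>) (real i + 1) (2 * real i + 1 + \<alpha>) (2 * real i + 1) 1))"
  proof (intro sum.cong refl)
    fix i assume "i \<in> {..k div 2}"
    then have "2 * i \<le> k" by auto
    then obtain q where q: "k = 2 * i + q" by (metis le_iff_add)
    define t where "t = (\<lambda>s. pochhammer (- real q) s * pochhammer (real i - \<nu>) s * pochhammer (real i + 1) s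
           / (pochhammer (2 * real i + 1 + \<alpha>) s * pochhammer (2 * real i + 1) s * fact s))"
    \<comment> \<open>The infinite series in \<open>hyp3F2\<close> terminates, since (-q)_s = 0 for
      s > q.\<close>
    have hyp: "hyp3F2 (- real (k - 2 * i)) (real i - \<nu>) (real i + 1) (2 * real i + 1 + \<alpha>) (2 * real i + 1) 1 = (\<Sum>s\<le>q. t s)"
      unfolding hyp3F2_def by (subst suminf_finite[of "{..q}"]) (auto simp: t_def q pochhammer_of_nat_eq_0_lemma)
    have "(\<Sum>m\<le>k. c m i) = (\<Sum>m=2*i..k. c m i)"
      by (intro sum.mono_neutral_right) (auto simp: c_def)
    also have "\<dots> = (\<Sum>s\<le>q. c (2 * i + s) i)"
      by (rule sum.reindex_bij_witness[of _ "\<lambda>s. 2 * i + s" "\<lambda>m. m - 2 * i"]) (auto simp: q)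
    also have "\<dots> = (\<Sum>s\<le>q. pochhammer (\<alpha> + 1) k * real (k choose (2 * i)) / pochhammer (\<alpha> + 1) (2 * i) * t s)"
    proof (intro sum.cong refl)
      fix s assume "s \<in> {..q}"
      then obtain r where r: "q = s + r" by (metis atMost_iff le_iff_add)
      \<comment> \<open>(\<alpha>+1)_k is cut into blocks of lengths 2i, s and r; the other symbols
        become factorial ratios, and the signs (-1)^s in \<open>P2\<close> and \<open>P5\<close>
        match.\<close>
      have P1: "pochhammer (\<alpha> + 1) k = pochhammer (\<alpha> + 1) (2 * i) * pochhammer (2 * real i + 1 + \<alpha>) s * pochhammer (\<alpha> + real (2 * i + s) + 1) r"
        using pochhammer_product'[of "\<alpha> + 1" "2 * i + s" r] pochhammer_product'[of "\<alpha> + 1" "2 * i" s]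
        by (simp add: q r add_ac)
      have P2: "pochhammer (\<nu> + real i - real (2 * i + s) + 1) s = (-1) ^ s * pochhammer (real i - \<nu>) s"
        using pochhammer_reflect[of 0 s "\<nu> - real i - real s"] by (simp add: algebra_simps)
      have F: "fact (a + b) = fact a * pochhammer (real a + 1) b" for a b
        using pochhammer_product'[of "1 :: real" a b] by (simp add: pochhammer_fact add_ac)
      have P3: "real ((i + s) choose i) = pochhammer (real i + 1) s / fact s"
        by (simp add: binomial_fact F)
      have P4: "pochhammer (2 * real i + 1) s = fact (2 * i + s) / fact (2 * i)"
        using F[of "2 * i" s] by simp
      have P5: "pochhammer (- real q) s = (-1) ^ s * (fact q / fact r)"
      proof -
        have "fact q / fact r = pochhammer (real r + 1) s"
          using F[of r s] by (simp add: r add.commute)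
        also have "\<dots> = (-1) ^ s * pochhammer (- real q) s"
          using pochhammer_reflect[of 0 s "real r"] by (simp add: r add_ac)
        finally show ?thesis by (simp flip: power_add mult.assoc)
      qed
      have P6: "real (k choose (2 * i + s)) = fact k / (fact (2 * i + s) * fact r)"
        "real (k choose (2 * i)) = fact k / (fact (2 * i) * fact q)"
        by (simp_all add: binomial_fact q r)
      have nz: "pochhammer (\<alpha> + 1) (2 * i) \<noteq> 0" "pochhammer (2 * real i + 1 + \<alpha>) s \<noteq> 0"
        using pp[of 0 "2 * i"] pp[of "2 * i" s] by (simp_all add: add_ac)
      have "c (2 * i + s) i = fact k / (fact (2 * i + s) * fact r) * pochhammer (\<alpha> + real (2 * i + s) + 1) r
          * (pochhammer (real i + 1) s / fact s * ((-1) ^ s * pochhammer (real i - \<nu>) s))"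
        unfolding c_def P6(1)[symmetric] P3[symmetric] P2[symmetric] by (simp add: q r)
      also have "\<dots> = pochhammer (\<alpha> + 1) k * real (k choose (2 * i)) / pochhammer (\<alpha> + 1) (2 * i) * t s"
        unfolding t_def P1 P4 P5 P6(2) using nz by (simp add: field_simps)
      finally show "c (2 * i + s) i = pochhammer (\<alpha> + 1) k * real (k choose (2 * i)) / pochhammer (\<alpha> + 1) (2 * i) * t s" .
    qed
    also have "\<dots> = pochhammer (\<alpha> + 1) k * real (k choose (2 * i)) / pochhammer (\<alpha> + 1) (2 * i) * (\<Sum>s\<le>q. t s)"
      by (simp only: sum_distrib_left)
    finally show "(\<Sum>m\<le>k. c m i) * x ^ i = pochhammer (\<alpha> + 1) k * (real (k choose (2 * i)) * x ^ i / pochhammer (\<alpha> + 1) (2 * i) *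
        hyp3F2 (- real (k - 2 * i)) (real i - \<nu>) (real i + 1) (2 * real i + 1 + \<alpha>) (2 * real i + 1) 1)"
      unfolding hyp by simp
  qed
  finally show ?thesis by (simp add: sum_distrib_left)
qed

lemma A_jjm1_eq:
  assumes "\<alpha> > -1"
  shows "A_jjm1 \<nu> \<alpha> j x = poly (rodr_poly \<nu> \<alpha> (2 * j)) x"
  unfolding A_jjm1_def rodr_poly_hyp3F2[OF assms]
  by (intro arg_cong2[of _ _ _ _ "(*)"] sum.cong refl) (auto simp: of_nat_diff algebra_simps)

lemma A_jj_eq:
  assumes "\<alpha> > -1"
  shows "A_jj \<nu> \<alpha> j x = poly (rodr_poly \<nu> \<alpha> (2 * j + 1)) x"
  unfolding A_jj_def rodr_poly_hyp3F2[OF assms]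
  by (intro arg_cong2[of _ _ _ _ "(*)"] sum.cong refl) (auto simp: of_nat_diff algebra_simps)

section \<open>The associated polynomials\<close>

lemma integral_eq_moment_fun:
  assumes "\<And>i. set_integrable lborel A (\<lambda>x. x ^ i * w x)"
    and "\<And>i. (LINT x:A|lborel. x ^ i * w x) = \<mu> i"
  shows "(LINT x:A|lborel. poly p x * w x) = moment_fun \<mu> p"
proof -
  have "(LINT x:A|lborel. poly p x * w x) = (LINT x|lborel. (\<Sum>i\<le>degree p. coeff p i * (indicator A x *\<^sub>R (x ^ i * w x))))"
    unfolding set_lebesgue_integral_def
    by (intro Bochner_Integration.integral_cong) (auto simp: poly_altdef sum_distrib_right sum_distrib_left mult_ac)
  also have "\<dots> = (\<Sum>i\<le>degree p. coeff p i * (LINT x:A|lborel. x ^ i * w x))"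
    using assms(1) unfolding set_integrable_def set_lebesgue_integral_def
    by (subst Bochner_Integration.integral_sum) auto
  finally show ?thesis unfolding assms(2) moment_fun_def .
qed

lemma integral_Gamma_eq_moment_fun:
  assumes "\<beta> > -1"
  shows "(LINT t:{0<..}|lborel. poly p t * (t powr \<beta> * exp (- t))) = moment_fun (\<lambda>i. Gamma (real i + \<beta> + 1)) p"
proof (rule integral_eq_moment_fun)
  fix i :: nat
  have pos: "real i + \<beta> + 1 > 0" using assms by linarith
  have eq: "t ^ i * (t powr \<beta> * exp (- t)) = t powr (real i + \<beta> + 1 - 1) * exp (- t)" if "t \<in> {0<..}" for t
    using that by (simp add: powr_add powr_realpow)
  show "set_integrable lborel {0<..} (\<lambda>t. t ^ i * (t powr \<beta> * exp (- t)))"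
    using Gamma_lebesgue(1)[OF pos] by (subst set_integrable_cong[OF refl refl eq]) auto
  show "(LINT t:{0<..}|lborel. t ^ i * (t powr \<beta> * exp (- t))) = Gamma (real i + \<beta> + 1)"
    using Gamma_lebesgue(2)[OF pos] by (subst set_lebesgue_integral_cong[of _ _ _ "\<lambda>t. t powr (real i + \<beta> + 1 - 1) * exp (- t)"]) (use eq in auto)
qed

lemma integral_rho_eq_moment_fun:
  assumes "\<alpha> > -1" "\<nu> \<ge> 0"
  shows "(LINT x:{0<..}|lborel. poly p x * (x powr \<alpha> * rho \<nu> x))
     = moment_fun (\<lambda>i. Gamma (real i + \<alpha> + 1) * Gamma (real i + \<alpha> + 1 + \<nu>)) p"
proof (rule integral_eq_moment_fun)
  fix i :: nat
  have pos: "real i + \<alpha> + 1 > 0" "real i + \<alpha> + 1 + \<nu> > 0" using assms by linarith+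
  have eq: "t ^ i * (t powr \<alpha> * rho \<nu> t) = t powr (real i + \<alpha> + 1 - 1) * rho \<nu> t" if "t \<in> {0<..}" for t
    using that by (simp add: powr_add powr_realpow)
  show "set_integrable lborel {0<..} (\<lambda>t. t ^ i * (t powr \<alpha> * rho \<nu> t))"
    using rho_Mellin(1)[OF pos] by (subst set_integrable_cong[OF refl refl eq]) auto
  show "(LINT t:{0<..}|lborel. t ^ i * (t powr \<alpha> * rho \<nu> t)) = Gamma (real i + \<alpha> + 1) * Gamma (real i + \<alpha> + 1 + \<nu>)"
    using rho_Mellin(2)[OF pos] by (subst set_lebesgue_integral_cong[of _ _ _ "\<lambda>t. t powr (real i + \<alpha> + 1 - 1) * rho \<nu> t"]) (use eq in auto)
qed

lemma moment_fun_mult_right: "moment_fun \<mu> (p * q) = (\<Sum>i\<le>degree p. coeff p i * moment_fun \<mu> (monom 1 i * q))"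
proof -
  have "p * q = (\<Sum>i\<le>degree p. smult (coeff p i) (monom 1 i * q))"
    by (subst poly_as_sum_of_monoms[symmetric]) (simp add: sum_distrib_right smult_monom flip: mult_smult_left)
  then show ?thesis by (simp add: moment_fun_sum moment_fun_smult)
qed

text \<open>For a power t^i with i < k the Gamma moment formula contains (i-k+1)_k, which has a zero
  factor.\<close>

lemma laguerre_orthogonal_low:
  assumes "\<beta> > -1" "degree p < k"
  shows "moment_fun (\<lambda>i. Gamma (real i + \<beta> + 1)) (p * laguerre_poly k \<beta>) = 0"
proof -
  have "moment_fun (\<lambda>i. Gamma (real i + \<beta> + 1)) (monom 1 i * laguerre_poly k \<beta>) = 0" if "i < k" for i
  proof -
    have "real i + \<beta> + 1 - \<beta> - real k = - real (k - 1 - i)" using that by simp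
    moreover have "pochhammer (- real (k - 1 - i)) k = 0"
      using that by (intro pochhammer_of_nat_eq_0_lemma) auto
    ultimately show ?thesis unfolding moment_fun_Gamma_laguerre[OF assms(1)] by simp
  qed
  then show ?thesis unfolding moment_fun_mult_right[of _ p] using assms(2) by simp
qed

lemma laguerre_orthogonal:
  assumes "\<beta> > -1"
  shows "moment_fun (\<lambda>i. Gamma (real i + \<beta> + 1)) (laguerre_poly j \<beta> * laguerre_poly k \<beta>)
      = (if j = k then Gamma (real k + \<beta> + 1) / fact k else 0)"
proof -
  consider "j < k" | "k < j" | "j = k" by linarith
  then show ?thesis
  proof cases
    case 1
    then show ?thesis using laguerre_orthogonal_low[OF assms, of "laguerre_poly j \<beta>" k] by simp
  next
    case 2
    then show ?thesis using laguerre_orthogonal_low[OF assms, of "laguerre_poly k \<beta>" j] by (simp add: mult.commute)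
  next
    case 3
    define L where "L = laguerre_poly k \<beta>"
    define M where "M = (\<lambda>i. moment_fun (\<lambda>i. Gamma (real i + \<beta> + 1)) (monom 1 i * L))"
    have low: "M i = 0" if "i < k" for i
      using laguerre_orthogonal_low[OF assms, of "monom 1 i" k] that
      by (simp add: M_def L_def degree_monom_eq)
    have "moment_fun (\<lambda>i. Gamma (real i + \<beta> + 1)) (L * L) = (\<Sum>i\<le>k. coeff L i * M i)"
      unfolding moment_fun_mult_right[of _ L] M_def by (simp add: L_def)
    \<comment> \<open>On the diagonal the lower moments vanish, so only the leading coefficient of
      one factor contributes.\<close>
    also have "\<dots> = coeff L k * M k"
      using low by (simp add: lessThan_Suc_atMost[symmetric])
    also have "coeff L k = (-1) ^ k / fact k"
      by (simp add: L_def coeff_laguerre_poly)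
    also have "M k = (-1) ^ k * Gamma (real k + \<beta> + 1)"
      unfolding M_def L_def moment_fun_Gamma_laguerre[OF assms] by (simp add: add_ac flip: pochhammer_fact)
    finally show ?thesis using 3 by (simp add: L_def flip: power_add)
  qed
qed

text \<open>Each x^k is replaced by the polynomial in t that
  \<open>moment_fun_power_laguerre\<close> sends to x^k rho_\<nu>(x), so the functional with moments
  \<open>rho (\<nu> + real i) x\<close> maps the result to p(x) rho_\<nu>(x).\<close>

definition assoc_poly :: "real \<Rightarrow> real poly \<Rightarrow> real poly" where
  "assoc_poly \<nu> p = (\<Sum>k\<le>degree p. smult (coeff p k * (-1) ^ k * fact k) (monom 1 k * laguerre_poly k \<nu>))"

lemma poly_assoc_poly: "degree (P n) = n \<Longrightarrow> poly (assoc_poly \<nu> (P n)) x = Qassoc \<nu> P n x"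
  by (simp add: assoc_poly_def Qassoc_def poly_sum poly_monom mult.assoc)

lemma degree_assoc_poly: "degree (assoc_poly \<nu> p) \<le> 2 * degree p"
  unfolding assoc_poly_def
proof (intro degree_sum_le)
  fix k assume "k \<in> {..degree p}"
  then show "degree (smult (coeff p k * (-1) ^ k * fact k) (monom 1 k * laguerre_poly k \<nu>)) \<le> 2 * degree p"
    by (auto simp: degree_mult_eq degree_monom_eq)
qed simp

text \<open>The Gamma moment of t^(m+k) L_k^\<nu> contains (m+\<alpha>+1)_k. The prefactor
  Gamma(m+\<alpha>+1) completes it to Gamma(m+k+\<alpha>+1), which yields exactly the moment of
  x^(m+k) against x^\<alpha> rho_\<nu>. Thus orthogonality of \<open>p\<close> to x^m passes to its
  associated polynomial.\<close>

lemma moment_fun_assoc_poly: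
  assumes \<alpha>: "\<alpha> > -1" and \<nu>: "\<nu> \<ge> 0"
  shows "Gamma (real m + \<alpha> + 1) * moment_fun (\<lambda>i. Gamma (real i + (\<nu> + \<alpha>) + 1)) (monom 1 m * assoc_poly \<nu> p)
     = moment_fun (\<lambda>i. Gamma (real i + \<alpha> + 1) * Gamma (real i + \<alpha> + 1 + \<nu>)) (p * monom 1 m)"
proof -
  have \<beta>: "\<nu> + \<alpha> > -1" using assms by linarith
  have pos: "real m + \<alpha> + 1 > 0" using \<alpha> by linarith
  have moment: "Gamma (real m + \<alpha> + 1) * ((-1) ^ k * fact k * moment_fun (\<lambda>i. Gamma (real i + (\<nu> + \<alpha>) + 1)) (monom 1 (m + k) * laguerre_poly k \<nu>))
     = Gamma (real (m + k) + \<alpha> + 1) * Gamma (real (m + k) + \<alpha> + 1 + \<nu>)" for k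
  proof -
    have "real m + \<alpha> + 1 \<notin> \<int>\<^sub>\<le>\<^sub>0" using pos by (auto elim!: nonpos_Ints_cases)
    from pochhammer_Gamma[OF this, of k] Gamma_real_pos[OF pos]
    have G: "Gamma (real (m + k) + \<alpha> + 1) = Gamma (real m + \<alpha> + 1) * pochhammer (real m + \<alpha> + 1) k"
      by (simp add: field_simps)
    have "real (m + k) + (\<nu> + \<alpha>) + 1 - \<nu> - real k = real m + \<alpha> + 1" by simp
    then show ?thesis
      unfolding moment_fun_Gamma_laguerre[OF \<beta>] G by (simp add: add_ac flip: power_add)
  qed
  have "Gamma (real m + \<alpha> + 1) * moment_fun (\<lambda>i. Gamma (real i + (\<nu> + \<alpha>) + 1)) (monom 1 m * assoc_poly \<nu> p)
    = (\<Sum>k\<le>degree p. coeff p k * (Gamma (real m + \<alpha> + 1) *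
       ((-1) ^ k * fact k * moment_fun (\<lambda>i. Gamma (real i + (\<nu> + \<alpha>) + 1)) (monom 1 (m + k) * laguerre_poly k \<nu>))))"
  proof -
    have shift: "monom 1 m * smult c (monom 1 k * L) = smult c (monom 1 (m + k) * L)" for k c and L :: "real poly"
      by (simp add: mult_monom flip: mult.assoc)
    show ?thesis
      unfolding assoc_poly_def sum_distrib_left shift moment_fun_sum moment_fun_smult by (simp add: mult_ac)
  qed
  also have "\<dots> = (\<Sum>k\<le>degree p. coeff p k * (Gamma (real (m + k) + \<alpha> + 1) * Gamma (real (m + k) + \<alpha> + 1 + \<nu>)))"
    unfolding moment ..
  also have "\<dots> = moment_fun (\<lambda>i. Gamma (real i + \<alpha> + 1) * Gamma (real i + \<alpha> + 1 + \<nu>)) (p * monom 1 m)"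
    unfolding moment_fun_mult_right[of _ p] by (simp add: mult_monom moment_fun_monom add_ac)
  finally show ?thesis .
qed

lemma orthonormal_family_orthogonal:
  assumes \<alpha>: "\<alpha> > -1" and \<nu>: "\<nu> \<ge> 0" and P: "orthonormal_family \<nu> \<alpha> P" and p: "degree p < n"
  shows "moment_fun (\<lambda>i. Gamma (real i + \<alpha> + 1) * Gamma (real i + \<alpha> + 1 + \<nu>)) (P n * p) = 0"
proof -
  have deg: "degree (P k) = k" "P k \<noteq> 0" for k
    using P unfolding orthonormal_family_def by (metis leading_coeff_0_iff less_irrefl)+
  obtain d where d: "p = (\<Sum>k\<le>degree p. smult (d k) (P k))"
    using poly_expand_basis[of P, OF deg le_refl] by blast
  have "moment_fun (\<lambda>i. Gamma (real i + \<alpha> + 1) * Gamma (real i + \<alpha> + 1 + \<nu>)) (P n * P k) = 0" if "k \<noteq> n" for k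
    using P that integral_rho_eq_moment_fun[OF \<alpha> \<nu>, of "P n * P k"]
    by (simp add: orthonormal_family_def mult.assoc)
  then have "moment_fun (\<lambda>i. Gamma (real i + \<alpha> + 1) * Gamma (real i + \<alpha> + 1 + \<nu>)) (P n * (\<Sum>k\<le>degree p. smult (d k) (P k))) = 0"
    using p by (simp add: sum_distrib_left moment_fun_sum moment_fun_smult)
  then show ?thesis using d by simp
qed

lemma ccoef_eq_moment_fun:
  assumes "\<alpha> > -1" "\<nu> \<ge> 0" "degree (P n) = n"
  shows "ccoef \<nu> \<alpha> P n k = fact k / Gamma (real k + \<nu> + \<alpha> + 1) *
    moment_fun (\<lambda>i. Gamma (real i + (\<nu> + \<alpha>) + 1)) (assoc_poly \<nu> (P n) * laguerre_poly k (\<nu> + \<alpha>))"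
proof -
  have \<beta>: "\<nu> + \<alpha> > -1" using assms by linarith
  show ?thesis
    unfolding ccoef_def integral_Gamma_eq_moment_fun[OF \<beta>, symmetric]
    by (simp add: poly_assoc_poly[where P = P, OF assms(3)] mult_ac)
qed

lemma ccoef_low:
  assumes \<alpha>: "\<alpha> > -1" and \<nu>: "\<nu> \<ge> 0" and P: "orthonormal_family \<nu> \<alpha> P" and k: "k < n"
  shows "ccoef \<nu> \<alpha> P n k = 0"
proof -
  have deg: "degree (P n) = n" using P by (simp add: orthonormal_family_def)
  have "moment_fun (\<lambda>i. Gamma (real i + (\<nu> + \<alpha>) + 1)) (monom 1 i * assoc_poly \<nu> (P n)) = 0" if "i \<le> k" for i
  proof -
    have "Gamma (real i + \<alpha> + 1) > 0" using \<alpha> by (intro Gamma_real_pos) linarith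
    moreover have "Gamma (real i + \<alpha> + 1) * moment_fun (\<lambda>i. Gamma (real i + (\<nu> + \<alpha>) + 1)) (monom 1 i * assoc_poly \<nu> (P n)) = 0"
      unfolding moment_fun_assoc_poly[OF \<alpha> \<nu>] using that k
      by (intro orthonormal_family_orthogonal \<alpha> \<nu> P) (simp add: degree_monom_eq)
    ultimately show ?thesis by simp
  qed
  then show ?thesis
    unfolding ccoef_eq_moment_fun[where P = P, OF \<alpha> \<nu> deg]
    by (subst mult.commute[of "assoc_poly _ _"]) (simp add: moment_fun_mult_right[of _ "laguerre_poly k (\<nu> + \<alpha>)"])
qed

lemma assoc_poly_expansion:
  assumes \<alpha>: "\<alpha> > -1" and \<nu>: "\<nu> \<ge> 0" and deg: "degree (P n) = n"
  shows "assoc_poly \<nu> (P n) = (\<Sum>k\<le>2*n. smult (ccoef \<nu> \<alpha> P n k) (laguerre_poly k (\<nu> + \<alpha>)))"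
proof -
  have \<beta>: "\<nu> + \<alpha> > -1" using assms by linarith
  have "degree (assoc_poly \<nu> (P n)) \<le> 2 * n" using degree_assoc_poly[of \<nu> "P n"] deg by simp
  then obtain d where d: "assoc_poly \<nu> (P n) = (\<Sum>k\<le>2*n. smult (d k) (laguerre_poly k (\<nu> + \<alpha>)))"
    using poly_expand_basis[of "\<lambda>k. laguerre_poly k (\<nu> + \<alpha>)"] by fastforce
  have "ccoef \<nu> \<alpha> P n j = d j" if "j \<le> 2 * n" for j
  proof -
    have "Gamma (real j + \<nu> + \<alpha> + 1) > 0" using \<beta> by (intro Gamma_real_pos) linarith
    then show ?thesis
      unfolding ccoef_eq_moment_fun[where P = P, OF \<alpha> \<nu> deg] d using that
      by (simp add: sum_distrib_right moment_fun_sum moment_fun_smult laguerre_orthogonal[OF \<beta>] mult_delta_right) (simp add: add.assoc)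
  qed
  then show ?thesis unfolding d by (intro sum.cong) auto
qed

lemma poly_times_rho:
  assumes \<alpha>: "\<alpha> > -1" and \<nu>: "\<nu> \<ge> 0" and P: "orthonormal_family \<nu> \<alpha> P" and x: "x > 0"
  shows "poly (P n) x * rho \<nu> x = (\<Sum>k\<in>{n..2*n}. ccoef \<nu> \<alpha> P n k / fact k *
     (\<Sum>m\<le>k. real (k choose m) * pochhammer (\<alpha> + real m + 1) (k - m) * (-1) ^ m * (x ^ m * rho (\<nu> - real m) x)))"
proof -
  have deg: "degree (P n) = n" using P by (simp add: orthonormal_family_def)
  note rec = rho_recurrence[OF x]
  define W where "W = moment_fun (\<lambda>i. rho (\<nu> + real i) x)"
  have "poly (P n) x * rho \<nu> x = (\<Sum>k\<le>n. coeff (P n) k * (x ^ k * rho \<nu> x))"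
    by (simp add: poly_altdef deg sum_distrib_right mult.assoc)
  also have "\<dots> = (\<Sum>k\<le>n. coeff (P n) k * ((-1) ^ k * fact k * W (monom 1 k * laguerre_poly k \<nu>)))"
    unfolding W_def moment_fun_power_laguerre[of "\<lambda>\<mu>. rho \<mu> x", OF rec] ..
  also have "\<dots> = W (assoc_poly \<nu> (P n))"
    by (simp add: W_def assoc_poly_def deg moment_fun_sum moment_fun_smult mult.assoc)
  also have "\<dots> = (\<Sum>k\<le>2*n. ccoef \<nu> \<alpha> P n k * W (laguerre_poly k (\<nu> + \<alpha>)))"
    unfolding assoc_poly_expansion[where P = P, OF \<alpha> \<nu> deg] by (simp add: W_def moment_fun_sum moment_fun_smult)
  also have "\<dots> = (\<Sum>k\<in>{n..2*n}. ccoef \<nu> \<alpha> P n k * W (laguerre_poly k (\<nu> + \<alpha>)))"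
    by (intro sum.mono_neutral_right) (auto simp: ccoef_low[OF \<alpha> \<nu> P])
  also have "\<dots> = (\<Sum>k\<in>{n..2*n}. ccoef \<nu> \<alpha> P n k / fact k * (fact k * W (laguerre_poly k (\<nu> + \<alpha>))))"
    by simp
  finally show ?thesis
    unfolding W_def moment_fun_laguerre[of "\<lambda>\<mu>. rho \<mu> x", OF rec] .
qed

section \<open>The Rodrigues formula and the explicit formula\<close>

lemma rodrigues_formula:
  assumes \<alpha>: "\<alpha> > -1" and \<nu>: "\<nu> \<ge> 0" and P: "orthonormal_family \<nu> \<alpha> P" and x: "x > 0"
  shows "poly (P n) x = x powr (- \<alpha>) / rho \<nu> x *
             (deriv ^^ n) (\<lambda>y. y powr (real n + \<alpha>) *
                (rho \<nu> y * rod_S1 \<nu> \<alpha> P n y + rho (\<nu> + 1) y * rod_S2 \<nu> \<alpha> P n y)) x"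
proof -
  define c where "c = (\<lambda>j. ccoef \<nu> \<alpha> P n (j + n) / fact (j + n))"
  \<comment> \<open>The candidate for the i-th derivative: the order j + i grows while the exponent
    n + \<alpha> - i falls, so that \<open>DERIV_rodr\<close> applies at every step.\<close>
  define g where "g = (\<lambda>i y. \<Sum>j\<le>n. c j * rodr \<nu> (j + i) (real n + \<alpha> - real i) y)"
  define s1 where "s1 = (\<lambda>j y. \<Sum>k\<le>j. \<Sum>m\<le>k. (-1) ^ k * pochhammer (real n + \<alpha> + \<nu> + real k + 1) (j - k) * pochhammer \<nu> (k - m)
          * real (j choose k) * real (k choose m) * poly (bessel_poly m \<nu>) y)"
  define s2 where "s2 = (\<lambda>j y. \<Sum>k\<le>j. \<Sum>m<k. (-1) ^ k * pochhammer (real n + \<alpha> + \<nu> + real k + 1) (j - k) * pochhammer \<nu> (k - m - 1)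
          * real (j choose k) * real (k choose (m + 1)) * poly (bessel_poly m (\<nu> - 1)) y)"
  have S1: "rod_S1 \<nu> \<alpha> P n y = (\<Sum>j\<le>n. c j * s1 j y)" for y
    unfolding rod_S1_def s1_def poly_bessel_poly c_def sum_distrib_left
    by (intro sum.cong refl) (simp add: power_add add_ac mult_ac)
  have shift: "\<nu> - 1 + real i - real m + 1 = \<nu> + real i - real m" for i m by simp
  have S2: "rod_S2 \<nu> \<alpha> P n y = (\<Sum>j\<le>n. c j * s2 j y)" for y
    unfolding rod_S2_def s2_def poly_bessel_poly shift c_def sum_distrib_left
    by (intro sum.cong refl) (simp add: power_add add_ac mult_ac)
  have "(deriv ^^ n) (\<lambda>y. y powr (real n + \<alpha>) *
                (rho \<nu> y * rod_S1 \<nu> \<alpha> P n y + rho (\<nu> + 1) y * rod_S2 \<nu> \<alpha> P n y)) x = g n x"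
  proof (rule higher_deriv_eq[OF _ _ x])
    fix y :: real assume y: "y > 0"
    show "y powr (real n + \<alpha>) * (rho \<nu> y * rod_S1 \<nu> \<alpha> P n y + rho (\<nu> + 1) y * rod_S2 \<nu> \<alpha> P n y) = g 0 y"
    proof -
      have "rodr \<nu> j (real n + \<alpha>) y = y powr (real n + \<alpha>) * (rho \<nu> y * s1 j y + rho (\<nu> + 1) y * s2 j y)" for j
        unfolding s1_def s2_def by (rule rodr_bessel_poly[OF y])
      then show ?thesis
        by (simp add: g_def S1 S2 sum.distrib sum_distrib_left distrib_left mult_ac)
    qed
  next
    fix i and y :: real assume "i < n" and y: "y > 0"
    show "(g i has_real_derivative g (Suc i) y) (at y)"
      unfolding g_def
    proof (intro DERIV_sum DERIV_cmult)
      fix j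
      show "(rodr \<nu> (j + i) (real n + \<alpha> - real i) has_real_derivative rodr \<nu> (j + Suc i) (real n + \<alpha> - real (Suc i)) y) (at y)"
      proof -
        have eq: "real n + \<alpha> - real (Suc i) + 1 = real n + \<alpha> - real i" by simp
        show ?thesis
          using DERIV_rodr[OF y, of \<nu> "j + i" "real n + \<alpha> - real (Suc i)"] unfolding eq by simp
      qed
    qed
  qed
  \<comment> \<open>After n steps the exponent is \<alpha> and the order is k = j + n, which runs
    over exactly the range n..2n that \<open>ccoef_low\<close> leaves.\<close>
  also have "g n x = x powr \<alpha> * (poly (P n) x * rho \<nu> x)"
  proof -
    have "(\<Sum>k\<in>{n..2*n}. h k) = (\<Sum>j\<le>n. h (j + n))" for h :: "nat \<Rightarrow> real"
      by (rule sum.reindex_bij_witness[of _ "\<lambda>j. j + n" "\<lambda>k. k - n"]) auto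
    then show ?thesis
      unfolding poly_times_rho[OF \<alpha> \<nu> P x] g_def rodr_eq[OF x]
      by (simp add: sum_distrib_left c_def mult_ac)
  qed
  finally show ?thesis
    using x rho_pos[OF x, of \<nu>] by (simp add: powr_minus field_simps)
qed

lemma poly_eq_sum_rodr_poly:
  assumes \<alpha>: "\<alpha> > -1" and \<nu>: "\<nu> \<ge> 0" and P: "orthonormal_family \<nu> \<alpha> P"
  shows "poly (P n) x = (\<Sum>k\<in>{n..2*n}. ccoef \<nu> \<alpha> P n k / fact k * poly (rodr_poly \<nu> \<alpha> k) x)"
proof -
  define B where "B = (\<lambda>k. \<Sum>m\<le>k. smult (real (k choose m) * pochhammer (\<alpha> + real m + 1) (k - m) * (-1) ^ m) (bessel_poly' m \<nu>))"
  define p where "p = P n - (\<Sum>k\<in>{n..2*n}. smult (ccoef \<nu> \<alpha> P n k / fact k) (rodr_poly \<nu> \<alpha> k))"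
  define q where "q = - (\<Sum>k\<in>{n..2*n}. smult (ccoef \<nu> \<alpha> P n k / fact k) (B k))"
  have "p = 0"
  proof (rule rho_linear_independent[OF \<nu>])
    fix x :: real assume x: "x > 0"
    have "(\<Sum>m\<le>k. real (k choose m) * pochhammer (\<alpha> + real m + 1) (k - m) * (-1) ^ m * (x ^ m * rho (\<nu> - real m) x))
       = poly (rodr_poly \<nu> \<alpha> k) x * rho \<nu> x + poly (B k) x * rho (\<nu> + 1) x" for k
      unfolding rho_shift_down[OF x] rodr_poly_def B_def
      by (simp add: poly_sum sum_distrib_right distrib_left sum.distrib mult.assoc)
    then have "poly (P n) x * rho \<nu> x = (\<Sum>k\<in>{n..2*n}. ccoef \<nu> \<alpha> P n k / fact k *
        (poly (rodr_poly \<nu> \<alpha> k) x * rho \<nu> x + poly (B k) x * rho (\<nu> + 1) x))"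
      unfolding poly_times_rho[OF \<alpha> \<nu> P x] by simp
    also have "\<dots> = (\<Sum>k\<in>{n..2*n}. ccoef \<nu> \<alpha> P n k / fact k * poly (rodr_poly \<nu> \<alpha> k) x) * rho \<nu> x
       + (\<Sum>k\<in>{n..2*n}. ccoef \<nu> \<alpha> P n k / fact k * poly (B k) x) * rho (\<nu> + 1) x"
      by (simp only: sum_distrib_right distrib_left sum.distrib mult.assoc)
    finally show "poly p x * rho \<nu> x + poly q x * rho (\<nu> + 1) x = 0"
      by (simp add: p_def q_def poly_sum algebra_simps)
  qed
  then have "P n = (\<Sum>k\<in>{n..2*n}. smult (ccoef \<nu> \<alpha> P n k / fact k) (rodr_poly \<nu> \<alpha> k))"
    by (simp add: p_def)
  then have "poly (P n) x = poly (\<Sum>k\<in>{n..2*n}. smult (ccoef \<nu> \<alpha> P n k / fact k) (rodr_poly \<nu> \<alpha> k)) x"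
    by simp
  then show ?thesis by (simp add: poly_sum)
qed

section \<open>Splitting the range of k by parity\<close>

lemma sum_even_odd_even:
  fixes f :: "nat \<Rightarrow> real"
  assumes "a \<le> b"
  shows "(\<Sum>k=2*a..2*b. f k) = (\<Sum>j=a..b. f (2 * j)) + (\<Sum>j=a..<b. f (2 * j + 1))"
  using assms by (induction b rule: dec_induct) (auto simp: algebra_simps)

lemma sum_even_odd_odd:
  fixes f :: "nat \<Rightarrow> real"
  assumes "a \<le> b"
  shows "(\<Sum>k=2*a+1..2*(b+1). f k) = (\<Sum>j=a..b. f (2 * (j + 1)) + f (2 * j + 1))"
  using assms by (induction b rule: dec_induct) (auto simp: algebra_simps)

theorem theorem3:
  fixes \<nu> \<alpha> :: real and P :: "nat \<Rightarrow> real poly"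
  assumes "\<nu> \<ge> 0" and "\<alpha> > -1"
    and "orthonormal_family \<nu> \<alpha> P"
  shows "(\<forall>n x. x > 0 \<longrightarrow>
           poly (P n) x = x powr (- \<alpha>) / rho \<nu> x *
             (deriv ^^ n) (\<lambda>y. y powr (real n + \<alpha>) *
                (rho \<nu> y * rod_S1 \<nu> \<alpha> P n y + rho (\<nu> + 1) y * rod_S2 \<nu> \<alpha> P n y)) x) \<and>
         (\<forall>n x. x > 0 \<longrightarrow>
           poly (P (2 * n)) x =
             (\<Sum>j=n..2*n. ccoef \<nu> \<alpha> P (2 * n) (2 * j) / fact (2 * j) * A_jjm1 \<nu> \<alpha> j x)
           + (\<Sum>j=n..<2*n. ccoef \<nu> \<alpha> P (2 * n) (2 * j + 1) / fact (2 * j + 1) * A_jj \<nu> \<alpha> j x)) \<and>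
         (\<forall>n x. x > 0 \<longrightarrow>
           poly (P (2 * n + 1)) x =
             (\<Sum>j=n..2*n. ccoef \<nu> \<alpha> P (2 * n + 1) (2 * (j + 1)) / fact (2 * (j + 1)) * A_jjm1 \<nu> \<alpha> (j + 1) x
                        + ccoef \<nu> \<alpha> P (2 * n + 1) (2 * j + 1) / fact (2 * j + 1) * A_jj \<nu> \<alpha> j x))"
proof (intro conjI allI impI)
  note asm = assms(2,1,3)
  fix n and x :: real assume x: "x > 0"
  show "poly (P n) x = x powr (- \<alpha>) / rho \<nu> x *
             (deriv ^^ n) (\<lambda>y. y powr (real n + \<alpha>) *
                (rho \<nu> y * rod_S1 \<nu> \<alpha> P n y + rho (\<nu> + 1) y * rod_S2 \<nu> \<alpha> P n y)) x"
    by (rule rodrigues_formula[OF asm x])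
  show "poly (P (2 * n)) x =
             (\<Sum>j=n..2*n. ccoef \<nu> \<alpha> P (2 * n) (2 * j) / fact (2 * j) * A_jjm1 \<nu> \<alpha> j x)
           + (\<Sum>j=n..<2*n. ccoef \<nu> \<alpha> P (2 * n) (2 * j + 1) / fact (2 * j + 1) * A_jj \<nu> \<alpha> j x)"
    unfolding A_jjm1_eq[OF assms(2)] A_jj_eq[OF assms(2)] poly_eq_sum_rodr_poly[OF asm, of "2 * n"]
    \<comment> \<open>Here k runs from 2n to 4n, both ends even, so the odd part stops at j = 2n -
      1.\<close>
    by (rule sum_even_odd_even) simp
  show "poly (P (2 * n + 1)) x =
             (\<Sum>j=n..2*n. ccoef \<nu> \<alpha> P (2 * n + 1) (2 * (j + 1)) / fact (2 * (j + 1)) * A_jjm1 \<nu> \<alpha> (j + 1) x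
                        + ccoef \<nu> \<alpha> P (2 * n + 1) (2 * j + 1) / fact (2 * j + 1) * A_jj \<nu> \<alpha> j x)"
    unfolding A_jjm1_eq[OF assms(2)] A_jj_eq[OF assms(2)] poly_eq_sum_rodr_poly[OF asm, of "2 * n + 1"]
    \<comment> \<open>Here k runs from 2n + 1 to 4n + 2, so odd and even indices pair up as 2j + 1
      and 2j + 2.\<close>
    by (rule sum_even_odd_odd) simp
qed

end
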